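(* Let $D$ be an integral domain satisfying the following conditions: ($\mathcal{C}1$) $D$ is polynomially L-regular; ($\mathcal{C}2$) for any nonnegative integer $n$ there exist only finitely many $t$-maximal ideals $\mathfrak{p}$ of $D$ with $N(\mathfrak{p})\le n$; ($\mathcal{C}5$) every $t$-maximal ideal of $D$ of finite norm is $t$-invertible. Then for every nonnegative integer $n$ the fractional ideals $\mathfrak{I}_n=\mathfrak{I}_n(D)$, $n!_D$, and $\Pi_n$ are $t$-invertible $t$-ideals, and one has $$\mathfrak{I}_n=(n!_D)^{-1}=\prod_{\mathfrak{p}\in t\text{-}\operatorname{Max}(D),\ N(\mathfrak{p})\le n}\left(\mathfrak{p}^{w_{N(\mathfrak{p})}(n)}\right)^{-1}$$ and $$n!_D=\prod_{\mathfrak{p}\in t\text{-}\operatorname{Max}(D),\ N(\mathfrak{p})\le n}\left(\mathfrak{p}^{w_{N(\mathfrak{p})}(n)}\right)_t=\prod_{1<q\le n}\left(\Pi_q^{w_q(n)}\right)_t.$$ Moreover, the group $\operatorname{POG}(D)$ is generated by (the classes of) any of the following sets: $\{q!_D: q\text{ is a prime power}\}$; $\{\mathfrak{I}_q: q\text{ is a prime power}\}$; and $\{\Pi_q: q\text{ is a prime power}\}$. In particular, the following conditions are equivalent. (1) $\operatorname{Int}(D)$ has a regular basis. (2) $\operatorname{POG}(D)$ is trivial. (3) $\mathfrak{I}_n$ is principal for every nonnegative integer $n$. (4) $\mathfrak{I}_q$ is principal for every prime power $q$. (5) $n!_D$ is principal for every nonnegative integer $n$. (6) $q!_D$ is principal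 for every prime power $q$. (7) $\Pi_n$ is principal for every nonnegative integer $n$. (8) $\Pi_q$ is principal for every prime power $q$.
   Context: Let $D$ be an integral domain with quotient field $K$. $\operatorname{Int}(D)=\{f\in K[X]: f(D)\subseteq D\}$. The $n$th characteristic ideal $\mathfrak{I}_n(D)\subseteq K$ is the set of coefficients of $X^n$ of the polynomials in $\operatorname{Int}(D)$ of degree at most $n$; it is a (nonzero) fractional ideal of $D$. The $n$th factorial ideal is $n!_D=\mathfrak{I}_n(D)^{-1}$. A regular basis of $\operatorname{Int}(D)$ is a $D$-module basis consisting of exactly one polynomial of each degree. For a nonzero fractional ideal $I$ of $D$, $I^{-1}=\{x\in K: xI\subseteq D\}$, $I_v=(I^{-1})^{-1}$, and $I_t=\bigcup J_v$ over the nonzero finitely generated $J\subseteq I$; $I$ is a $t$-ideal if $I_t=I$, and $t$-invertible if $(II^{-1})_t=D$. A $t$-maximal ideal of $D$ is an ideal maximal among the nonzero proper ideals of $D$ that are $t$-ideals; $t\text{-}\operatorname{Max}(D)$ is the set of all of them. The norm of an ideal $\mathfrak{a}$ is $N(\mathfrak{a})=|D/\mathfrak{a}|$. For a nonnegative integer $n$, $\Pi_n=\Pi_n(D)$ is the intersection of all $t$-maximal ideals of $D$ of norm $n$ (equal to $D$ if there are none, in particular if $n$ is not a prime power). The $t$-class group $\operatorname{Cl}_t(D)$ is the group of $t$-invertible $t$-ideals under $(I,J)\mapsto (IJ)_t$ modulo the subgroup of nonzero principal fractional ideals. When all $\mathfrak{I}_n(D)$ are $t$-invertible $t$-ideals,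 the Pólya–Ostrowski group $\operatorname{POG}(D)$ is the subgroup of $\operatorname{Cl}_t(D)$ generated by the classes of the $\mathfrak{I}_n(D)$ for all $n$. $D$ is polynomially L-regular if $S^{-1}\operatorname{Int}(D)=\operatorname{Int}(S^{-1}D)$ for every multiplicative subset $S$ of $D$ (with $0\notin S$). For a nonnegative integer $n$ and an integer $k>1$, $w_k(n)=\sum_{i=1}^\infty\lfloor n/k^i\rfloor$. *)

theory Defs
  imports
    "HOL-Algebra.Coset"
    "HOL-Algebra.FiniteProduct"
    "HOL-Algebra.Generated_Groups"
    "HOL-Computational_Algebra.Polynomial"
    "HOL-Number_Theory.Prime_Powers"
    "HOL-Library.Extended_Nat"
begin

text \<open>
  An integral domain is given as a subring \<open>D\<close> of a field \<open>'k\<close> that is the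
  quotient field of \<open>D\<close>. The localizations of \<open>D\<close> are then subsets of \<open>'k\<close> too.
\<close>

locale domain_with_quotient_field =
  fixes D :: "'k::field set"
  assumes one_mem: "1 \<in> D"
    and diff_mem: "\<lbrakk>x \<in> D; y \<in> D\<rbrakk> \<Longrightarrow> x - y \<in> D"
    and mult_mem: "\<lbrakk>x \<in> D; y \<in> D\<rbrakk> \<Longrightarrow> x * y \<in> D"
    and quotient: "\<exists>a\<in>D. \<exists>b\<in>D. b \<noteq> 0 \<and> x = a / b"

definition D_submodule :: "'k::field set \<Rightarrow> 'k set \<Rightarrow> bool" where
  "D_submodule D M \<longleftrightarrow>
     0 \<in> M \<and> (\<forall>x\<in>M. \<forall>y\<in>M. x + y \<in> M) \<and> (\<forall>d\<in>D. \<forall>x\<in>M. d * x \<in> M)"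

definition D_span :: "'k::field set \<Rightarrow> 'k set \<Rightarrow> 'k set" where
  "D_span D X = D_submodule D hull X"

definition nonzero_frac_ideal :: "'k::field set \<Rightarrow> 'k set \<Rightarrow> bool" where
  "nonzero_frac_ideal D I \<longleftrightarrow>
     D_submodule D I \<and> I \<noteq> {0} \<and> (\<exists>d\<in>D. d \<noteq> 0 \<and> (\<forall>x\<in>I. d * x \<in> D))"

definition principal_frac_ideal :: "'k::field set \<Rightarrow> 'k set \<Rightarrow> bool" where
  "principal_frac_ideal D I \<longleftrightarrow> (\<exists>c. c \<noteq> 0 \<and> I = (\<lambda>x. c * x) ` D)"

definition ideal_mult :: "'k::field set \<Rightarrow> 'k set \<Rightarrow> 'k set \<Rightarrow> 'k set" where
  "ideal_mult D I J = D_span D {a * b |a b. a \<in> I \<and> b \<in> J}"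

text \<open>
  Products and powers of fractional ideals are those of the following commutative monoid,
  so they are ordinary ideal products; empty products and zeroth powers are \<open>D\<close>.
\<close>

definition frac_ideals :: "'k::field set \<Rightarrow> 'k set monoid" where
  "frac_ideals D =
     \<lparr>carrier = {I. nonzero_frac_ideal D I}, monoid.mult = ideal_mult D, one = D\<rparr>"

definition ideal_inv :: "'k::field set \<Rightarrow> 'k set \<Rightarrow> 'k set" where
  "ideal_inv D I = {x. \<forall>y\<in>I. x * y \<in> D}"

definition v_closure :: "'k::field set \<Rightarrow> 'k set \<Rightarrow> 'k set" where
  "v_closure D I = ideal_inv D (ideal_inv D I)"

definition t_closure :: "'k::field set \<Rightarrow> 'k set \<Rightarrow> 'k set" where
  "t_closure D I =
     \<Union> {v_closure D J |J. J \<subseteq> I \<and> J \<noteq> {0} \<and> (\<exists>F. finite F \<and> J = D_span D F)}"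

definition t_ideal :: "'k::field set \<Rightarrow> 'k set \<Rightarrow> bool" where
  "t_ideal D I \<longleftrightarrow> nonzero_frac_ideal D I \<and> t_closure D I = I"

definition t_invertible :: "'k::field set \<Rightarrow> 'k set \<Rightarrow> bool" where
  "t_invertible D I \<longleftrightarrow>
     nonzero_frac_ideal D I \<and> t_closure D (ideal_mult D I (ideal_inv D I)) = D"

definition t_Max :: "'k::field set \<Rightarrow> 'k set set" where
  "t_Max D = {P. t_ideal D P \<and> P \<subset> D \<and> (\<forall>Q. t_ideal D Q \<and> Q \<subset> D \<and> P \<subseteq> Q \<longrightarrow> Q = P)}"

text \<open>The norm takes values in \<^typ>\<open>enat\<close>, since \<^const>\<open>card\<close> is \<open>0\<close> on infinite sets.\<close>

definition ideal_norm :: "'k::field set \<Rightarrow> 'k set \<Rightarrow> enat" where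
  "ideal_norm D I =
     (let Q = (\<lambda>x. (\<lambda>y. x + y) ` I) ` D in if finite Q then enat (card Q) else \<infinity>)"

definition Pi_ideal :: "'k::field set \<Rightarrow> nat \<Rightarrow> 'k set" where
  "Pi_ideal D n = D \<inter> \<Inter> {P \<in> t_Max D. ideal_norm D P = enat n}"

definition Int_poly :: "'k::field set \<Rightarrow> 'k poly set" where
  "Int_poly R = {f. \<forall>x\<in>R. poly f x \<in> R}"

definition char_ideal :: "'k::field set \<Rightarrow> nat \<Rightarrow> 'k set" where
  "char_ideal D n = {coeff f n |f. f \<in> Int_poly D \<and> degree f \<le> n}"

definition factorial_ideal :: "'k::field set \<Rightarrow> nat \<Rightarrow> 'k set" where
  "factorial_ideal D n = ideal_inv D (char_ideal D n)"

definition multiplicative_subset :: "'k::field set \<Rightarrow> 'k set \<Rightarrow> bool" where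
  "multiplicative_subset D S \<longleftrightarrow>
     S \<subseteq> D \<and> 1 \<in> S \<and> 0 \<notin> S \<and> (\<forall>s\<in>S. \<forall>t\<in>S. s * t \<in> S)"

definition localization :: "'k::field set \<Rightarrow> 'k set \<Rightarrow> 'k set" where
  "localization S D = {a / s |a s. a \<in> D \<and> s \<in> S}"

definition poly_localization :: "'k::field set \<Rightarrow> 'k poly set \<Rightarrow> 'k poly set" where
  "poly_localization S M = {smult (1 / s) f |f s. f \<in> M \<and> s \<in> S}"

definition polynomially_L_regular :: "'k::field set \<Rightarrow> bool" where
  "polynomially_L_regular D \<longleftrightarrow>
     (\<forall>S. multiplicative_subset D S \<longrightarrow>
        poly_localization S (Int_poly D) = Int_poly (localization S D))"

definition poly_module_basis :: "'k::field set \<Rightarrow> 'k poly set \<Rightarrow> 'k poly set \<Rightarrow> bool" where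
  "poly_module_basis D M B \<longleftrightarrow>
     M = {\<Sum>b\<in>F. smult (c b) b |F c. finite F \<and> F \<subseteq> B \<and> c ` F \<subseteq> D} \<and>
     (\<forall>F c. finite F \<and> F \<subseteq> B \<and> c ` F \<subseteq> D \<and> (\<Sum>b\<in>F. smult (c b) b) = 0
        \<longrightarrow> (\<forall>b\<in>F. c b = 0))"

definition regular_basis :: "'k::field set \<Rightarrow> 'k poly set \<Rightarrow> bool" where
  "regular_basis D B \<longleftrightarrow>
     poly_module_basis D (Int_poly D) B \<and> (\<forall>n. \<exists>!b. b \<in> B \<and> degree b = n)"

definition t_group :: "'k::field set \<Rightarrow> 'k set monoid" where
  "t_group D =
     \<lparr>carrier = {I. t_ideal D I \<and> t_invertible D I},
      monoid.mult = (\<lambda>I J. t_closure D (ideal_mult D I J)), one = D\<rparr>"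

definition t_class_group :: "'k::field set \<Rightarrow> 'k set set monoid" where
  "t_class_group D = t_group D Mod {I. principal_frac_ideal D I}"

definition t_class :: "'k::field set \<Rightarrow> 'k set \<Rightarrow> 'k set set" where
  "t_class D I = {J. principal_frac_ideal D J} #>\<^bsub>t_group D\<^esub> I"

definition POG :: "'k::field set \<Rightarrow> 'k set set set" where
  "POG D = generate (t_class_group D) (t_class D ` range (char_ideal D))"

text \<open>For \<open>k > 1\<close> the terms vanish for large \<open>i\<close>.\<close>

definition w_exp :: "nat \<Rightarrow> nat \<Rightarrow> nat" where
  "w_exp k n = (\<Sum>i. n div k ^ Suc i)"

end

theory Submission
  imports Defs "HOL-Algebra.Sylow"
begin

text \<open>
  At a t-maximal ideal \<open>P\<close> of finite norm \<open>q\<close>, t-invertibility makes \<open>P D\<^sub>P\<close> principal with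
  residue field of \<open>q\<close> elements, and interpolation along a sequence built from base-\<open>q\<close> digits
  shows that the leading coefficients of degree-\<open>n\<close> integer-valued polynomials generate
  \<open>P\<^sup>-\<^sup>w D\<^sub>P\<close> with \<open>w = w\<^sub>q(n)\<close>; at infinite norm they lie in \<open>D\<^sub>P\<close>. The upper bound
  \<open>\<II>\<^sub>n \<subseteq> (\<Prod> P\<^sup>w)\<^sup>-\<^sup>1\<close> follows because \<open>D\<close> is the intersection of its localizations at t-maximal
  ideals. For the lower bound, the conductor of an element of the right-hand side into \<open>\<II>\<^sub>n\<close>
  contains \<open>\<Prod> P\<^sup>w\<close>, and by polynomial L-regularity it is contained in none of the finitely many
  \<open>P\<close>, which are maximal, so it is \<open>D\<close>. All product formulas then come from comaximality, and
  the statements on the Polya-Ostrowski group from \<open>w\<^sub>q(q) = 1\<close>, which lets one solve for the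
  class of \<open>\<Pi>\<^sub>q\<close> inductively.
\<close>

text \<open>The two bounds on \<open>char_ideal D n\<close> need different arguments. Membership in
  \<open>D\<close> can be tested at all t-maximal ideals, but \<open>char_ideal D n\<close> is not
  known in advance to be a t-ideal, and an ideal lying in no t-maximal ideal need not be
  \<open>D\<close>. The lower bound therefore relies on genuine comaximality: t-maximal ideals of
  finite norm are maximal ideals, since finite domains are fields, and condition C2 leaves only
  finitely many of them for each \<open>n\<close>. Comaximality also explains the shape of the
  formulas, ordinary products with the t-closure on each factor only: comaximal products are
  intersections, and inverses and v-closures pass through them. Besides making \<open>P\<close>
  locally principal, t-invertibility identifies t-closure with v-closure on the ideals in question,
  so that the t-closures can be computed by inverses. Replacing all \<open>n\<close> by prime powers
  rests on one more fact: the norm of a t-maximal ideal is a prime power, so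
  \<open>Pi_ideal D q = D\<close> for every other \<open>q\<close>.\<close>

context domain_with_quotient_field
begin

abbreviation ideal_times (infixl "\<odot>" 70) where "I \<odot> J \<equiv> ideal_mult D I J"
abbreviation "inv_ideal \<equiv> ideal_inv D"
abbreviation "vc \<equiv> v_closure D"
abbreviation "tc \<equiv> t_closure D"
abbreviation "submod \<equiv> D_submodule D"
abbreviation "fideal \<equiv> nonzero_frac_ideal D"

subsection \<open>Fractional ideals\<close>

lemma zero_mem: "0 \<in> D" using diff_mem[OF one_mem one_mem] by simp
lemma neg_mem: "x \<in> D \<Longrightarrow> - x \<in> D" using diff_mem[OF zero_mem, of x] by simp
lemma add_mem: "x \<in> D \<Longrightarrow> y \<in> D \<Longrightarrow> x + y \<in> D" using diff_mem[of x "- y"] neg_mem by simp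
lemma power_mem: "x \<in> D \<Longrightarrow> x ^ n \<in> D" by (induction n) (auto simp: one_mem mult_mem)

lemma submodI:
  assumes "0 \<in> M" "\<And>x y. x \<in> M \<Longrightarrow> y \<in> M \<Longrightarrow> x + y \<in> M" "\<And>d x. d \<in> D \<Longrightarrow> x \<in> M \<Longrightarrow> d * x \<in> M"
  shows "submod M"
  using assms by (auto simp: D_submodule_def)

lemma submod_zero: "submod M \<Longrightarrow> 0 \<in> M"
  and submod_add: "submod M \<Longrightarrow> x \<in> M \<Longrightarrow> y \<in> M \<Longrightarrow> x + y \<in> M"
  and submod_mult: "submod M \<Longrightarrow> d \<in> D \<Longrightarrow> x \<in> M \<Longrightarrow> d * x \<in> M"
  by (auto simp: D_submodule_def)

lemma submod_mult_right: "submod M \<Longrightarrow> x \<in> M \<Longrightarrow> d \<in> D \<Longrightarrow> x * d \<in> M"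
  using submod_mult by (simp add: mult.commute)

lemma submod_diff: assumes "submod M" "x \<in> M" "y \<in> M" shows "x - y \<in> M"
  using submod_add[OF assms(1,2) submod_mult[OF assms(1) neg_mem[OF one_mem] assms(3)]] by simp

lemma submod_D: "submod D"
  by (rule submodI) (auto intro: zero_mem add_mem mult_mem)

lemma submod_Inter: "(\<And>M. M \<in> X \<Longrightarrow> submod M) \<Longrightarrow> submod (\<Inter>X)"
  by (auto simp: D_submodule_def)

lemma submod_Int: "submod M \<Longrightarrow> submod N \<Longrightarrow> submod (M \<inter> N)"
  by (auto simp: D_submodule_def)

text \<open>Placing a span inside such a colon submodule is a recurring device: inclusions are
  checked on generators, and linear combinations are never written out.\<close>

lemma submod_colon: "submod M \<Longrightarrow> submod {x. \<forall>y\<in>Y. x * y \<in> M}"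
  by (rule submodI) (auto simp: distrib_right mult.assoc submod_zero submod_add submod_mult)

lemma submod_span: "submod (D_span D X)"
  unfolding D_span_def by (rule hull_in) (auto intro: submod_Inter)

lemma span_superset: "X \<subseteq> D_span D X"
  unfolding D_span_def by (rule hull_subset)

lemma span_least: "submod M \<Longrightarrow> X \<subseteq> M \<Longrightarrow> D_span D X \<subseteq> M"
  unfolding D_span_def by (rule hull_minimal)

lemma span_mono: "X \<subseteq> Y \<Longrightarrow> D_span D X \<subseteq> D_span D Y"
  unfolding D_span_def by (rule hull_mono)

lemma span_eq_zero_iff: "D_span D X = {0} \<longleftrightarrow> X \<subseteq> {0}"
proof
  show "X \<subseteq> {0} \<Longrightarrow> D_span D X = {0}"
    using span_least[of "{0}" X] submod_zero[OF submod_span, of X] by (auto simp: D_submodule_def)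
qed (use span_superset in blast)

lemma submod_image_mult: assumes "submod M" shows "submod ((*) c ` M)"
proof (rule submodI)
  show "0 \<in> (*) c ` M" using submod_zero[OF assms] by (rule rev_image_eqI) simp
next
  fix x y assume "x \<in> (*) c ` M" "y \<in> (*) c ` M"
  then show "x + y \<in> (*) c ` M" by (auto simp: distrib_left[symmetric] intro: submod_add[OF assms])
next
  fix d x assume "d \<in> D" "x \<in> (*) c ` M"
  then show "d * x \<in> (*) c ` M" by (auto simp: mult.left_commute[of d] intro: submod_mult[OF assms])
qed

lemma span_image_mult: "D_span D ((*) c ` X) = (*) c ` D_span D X"
proof
  show "D_span D ((*) c ` X) \<subseteq> (*) c ` D_span D X"
    by (intro span_least submod_image_mult submod_span image_mono span_superset)
  have "D_span D X \<subseteq> {x. \<forall>y\<in>{c}. x * y \<in> D_span D ((*) c ` X)}"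
    by (intro span_least submod_colon submod_span) (use span_superset[of "(*) c ` X"] in \<open>auto simp: mult.commute\<close>)
  then show "(*) c ` D_span D X \<subseteq> D_span D ((*) c ` X)"
    by (auto simp: mult.commute)
qed

lemma ideal_mult_subset_iff: "submod M \<Longrightarrow> I \<odot> J \<subseteq> M \<longleftrightarrow> (\<forall>x\<in>I. \<forall>y\<in>J. x * y \<in> M)"
  using span_superset[of "{a * b |a b. a \<in> I \<and> b \<in> J}"] span_least[of M "{a * b |a b. a \<in> I \<and> b \<in> J}"]
  unfolding ideal_mult_def by blast

lemma submod_ideal_mult: "submod (I \<odot> J)"
  unfolding ideal_mult_def by (rule submod_span)

lemma ideal_mult_mem: "x \<in> I \<Longrightarrow> y \<in> J \<Longrightarrow> x * y \<in> I \<odot> J"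
  using ideal_mult_subset_iff[OF submod_ideal_mult, of I J I J] by blast

lemma ideal_mult_commute: "I \<odot> J = J \<odot> I"
  unfolding ideal_mult_def by (rule arg_cong[where f = "D_span D"]) (blast intro: mult.commute)

lemma ideal_mult_mono: "I \<subseteq> I' \<Longrightarrow> J \<subseteq> J' \<Longrightarrow> I \<odot> J \<subseteq> I' \<odot> J'"
  by (subst ideal_mult_subset_iff[OF submod_ideal_mult]) (auto intro: ideal_mult_mem)

lemma ideal_mult_subset_iff3:
  assumes "submod M"
  shows "(I \<odot> J) \<odot> K \<subseteq> M \<longleftrightarrow> (\<forall>x\<in>I. \<forall>y\<in>J. \<forall>z\<in>K. x * y * z \<in> M)"
proof -
  have "(I \<odot> J) \<odot> K \<subseteq> M \<longleftrightarrow> I \<odot> J \<subseteq> {x. \<forall>z\<in>K. x * z \<in> M}"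
    by (subst ideal_mult_subset_iff[OF assms]) auto
  also have "\<dots> \<longleftrightarrow> (\<forall>x\<in>I. \<forall>y\<in>J. \<forall>z\<in>K. x * y * z \<in> M)"
    by (subst ideal_mult_subset_iff[OF submod_colon[OF assms]]) auto
  finally show ?thesis .
qed

lemma ideal_mult_assoc: "(I \<odot> J) \<odot> K = I \<odot> (J \<odot> K)"
proof
  show "(I \<odot> J) \<odot> K \<subseteq> I \<odot> (J \<odot> K)"
    by (subst ideal_mult_subset_iff3[OF submod_ideal_mult]) (auto simp: mult.assoc intro!: ideal_mult_mem)
  have "(K \<odot> J) \<odot> I \<subseteq> I \<odot> J \<odot> K"
    by (subst ideal_mult_subset_iff3[OF submod_ideal_mult])
       (metis ideal_mult_mem mult.commute mult.left_commute)
  then show "I \<odot> (J \<odot> K) \<subseteq> (I \<odot> J) \<odot> K"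
    by (simp add: ideal_mult_commute)
qed

lemma ideal_mult_D: "submod I \<Longrightarrow> D \<odot> I = I"
  by (intro equalityI)
     (auto simp: ideal_mult_subset_iff submod_mult intro: ideal_mult_mem[OF one_mem, of _ I, simplified])

lemma fracI:
  assumes "submod I" "x \<in> I" "x \<noteq> 0" "d \<in> D" "d \<noteq> 0" "\<And>y. y \<in> I \<Longrightarrow> d * y \<in> D"
  shows "fideal I"
  using assms by (auto simp: nonzero_frac_ideal_def)

lemma frac_submod: "fideal I \<Longrightarrow> submod I"
  by (simp add: nonzero_frac_ideal_def)

lemma frac_nonzero: assumes "fideal I" obtains x where "x \<in> I" "x \<noteq> 0"
  using assms submod_zero[OF frac_submod[OF assms]] by (auto simp: nonzero_frac_ideal_def)

lemma frac_denom: assumes "fideal I" obtains d where "d \<in> D" "d \<noteq> 0" "\<And>y. y \<in> I \<Longrightarrow> d * y \<in> D"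
  using assms by (auto simp: nonzero_frac_ideal_def)

lemma frac_integral_nonzero: assumes "fideal I" obtains x where "x \<in> I" "x \<in> D" "x \<noteq> 0"
proof -
  obtain x where x: "x \<in> I" "x \<noteq> 0" using frac_nonzero[OF assms] .
  obtain d where d: "d \<in> D" "d \<noteq> 0" "\<And>y. y \<in> I \<Longrightarrow> d * y \<in> D" using frac_denom[OF assms] by blast
  show thesis using that[of "d * x"] x d submod_mult[OF frac_submod[OF assms]] by auto
qed

lemma frac_D: "fideal D"
  by (rule fracI[OF submod_D one_mem _ one_mem]) auto

lemma frac_integral: "submod I \<Longrightarrow> I \<subseteq> D \<Longrightarrow> x \<in> I \<Longrightarrow> x \<noteq> 0 \<Longrightarrow> fideal I"
  by (rule fracI[of I x 1]) (auto simp: one_mem)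

lemma frac_mult: assumes "fideal I" "fideal J" shows "fideal (I \<odot> J)"
proof -
  obtain x y where x: "x \<in> I" "x \<noteq> 0" and y: "y \<in> J" "y \<noteq> 0" using frac_nonzero assms by metis
  obtain d where d: "d \<in> D" "d \<noteq> 0" "\<And>y. y \<in> I \<Longrightarrow> d * y \<in> D" using frac_denom[OF assms(1)] by blast
  obtain e where e: "e \<in> D" "e \<noteq> 0" "\<And>y. y \<in> J \<Longrightarrow> e * y \<in> D" using frac_denom[OF assms(2)] by blast
  have "I \<odot> J \<subseteq> {z. \<forall>c\<in>{d * e}. z * c \<in> D}"
  proof (subst ideal_mult_subset_iff[OF submod_colon[OF submod_D]], intro ballI, simp)
    fix a b assume "a \<in> I" "b \<in> J"
    then have "(d * a) * (e * b) \<in> D" using d e mult_mem by blast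
    then show "a * b * (d * e) \<in> D" by (simp add: mult_ac)
  qed
  then show ?thesis
    using x y d e by (intro fracI[of _ "x * y" "d * e"])
      (auto simp: submod_ideal_mult ideal_mult_mem mult_mem mult.commute)
qed

lemma submod_inv: "submod (inv_ideal I)"
  unfolding ideal_inv_def by (rule submod_colon[OF submod_D])

lemma inv_mem_mult: "x \<in> inv_ideal I \<Longrightarrow> y \<in> I \<Longrightarrow> x * y \<in> D"
  by (simp add: ideal_inv_def)

lemma frac_inv: assumes "fideal I" shows "fideal (inv_ideal I)"
proof -
  obtain x where x: "x \<in> I" "x \<in> D" "x \<noteq> 0" using frac_integral_nonzero[OF assms] .
  obtain d where d: "d \<in> D" "d \<noteq> 0" "\<And>y. y \<in> I \<Longrightarrow> d * y \<in> D" using frac_denom[OF assms] by blast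
  \<comment> \<open>The roles swap: a denominator \<open>d\<close> of \<open>I\<close> is a nonzero
    element of the inverse, and a nonzero integral element \<open>x\<close> of \<open>I\<close> is a
    denominator of the inverse.\<close>
  show ?thesis
    by (rule fracI[OF submod_inv, of d _ x]) (use x d in \<open>auto simp: ideal_inv_def mult.commute\<close>)
qed

lemma inv_antimono: "I \<subseteq> J \<Longrightarrow> inv_ideal J \<subseteq> inv_ideal I"
  by (auto simp: ideal_inv_def)

lemma inv_D: "inv_ideal D = D"
  using one_mem by (force simp: ideal_inv_def intro: mult_mem)

lemma mult_inv_subset: "I \<odot> inv_ideal I \<subseteq> D"
  by (subst ideal_mult_subset_iff[OF submod_D]) (auto simp: ideal_inv_def mult.commute)

lemma subset_inv_iff: "submod I \<Longrightarrow> I \<subseteq> inv_ideal J \<longleftrightarrow> I \<odot> J \<subseteq> D"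
  by (subst ideal_mult_subset_iff[OF submod_D]) (auto simp: ideal_inv_def)

lemma subset_vc: "I \<subseteq> vc I"
  by (auto simp: v_closure_def ideal_inv_def mult.commute)

lemma vc_mono: "I \<subseteq> J \<Longrightarrow> vc I \<subseteq> vc J"
  unfolding v_closure_def by (intro inv_antimono)

lemma inv_vc: "inv_ideal (vc I) = inv_ideal I"
  using subset_vc[of "inv_ideal I"] inv_antimono[OF subset_vc[of I]] by (auto simp: v_closure_def)

lemma vc_inv: "vc (inv_ideal I) = inv_ideal I"
  using inv_vc[of I] by (simp add: v_closure_def)

lemma vc_vc: "vc (vc I) = vc I"
  using vc_inv[of "inv_ideal I"] by (simp add: v_closure_def)

lemma vc_D: "vc D = D"
  by (simp add: v_closure_def inv_D)

lemma vc_least: "I \<subseteq> J \<Longrightarrow> vc J = J \<Longrightarrow> vc I \<subseteq> J"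
  using vc_mono[of I J] by simp

lemma submod_vc: "submod (vc I)"
  unfolding v_closure_def by (rule submod_inv)

lemma vc_image_mult: "(*) c ` vc I \<subseteq> vc ((*) c ` I)"
proof (cases "c = 0")
  case True then show ?thesis using submod_zero[OF submod_vc] by auto
next
  case False
  show ?thesis
  proof safe
    fix x assume x: "x \<in> vc I"
    have "c * x * y \<in> D" if y: "y \<in> inv_ideal ((*) c ` I)" for y
    proof -
      have "c * y \<in> inv_ideal I" using y by (auto simp: ideal_inv_def mult_ac)
      then have "x * (c * y) \<in> D" using x inv_mem_mult unfolding v_closure_def by blast
      then show ?thesis by (simp add: mult_ac)
    qed
    then show "c * x \<in> vc ((*) c ` I)" by (simp add: v_closure_def ideal_inv_def)
  qed
qed

subsection \<open>The t-operation\<close>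

text \<open>With finite generating sets in place of finitely generated submodules, directedness
  amounts to taking unions of finite sets. The condition that \<open>F\<close> has a nonzero element
  excludes the zero submodule.\<close>

lemma tc_mem_iff:
  assumes "submod I"
  shows "x \<in> tc I \<longleftrightarrow> (\<exists>F. finite F \<and> F \<subseteq> I \<and> \<not> F \<subseteq> {0} \<and> x \<in> vc (D_span D F))"
proof
  assume "x \<in> tc I"
  then obtain F where "x \<in> vc (D_span D F)" "D_span D F \<subseteq> I" "D_span D F \<noteq> {0}" "finite F"
    by (auto simp: t_closure_def)
  moreover from this have "F \<subseteq> I" using span_superset by blast
  ultimately show "\<exists>F. finite F \<and> F \<subseteq> I \<and> \<not> F \<subseteq> {0} \<and> x \<in> vc (D_span D F)"
    by (auto simp: span_eq_zero_iff)
next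
  assume "\<exists>F. finite F \<and> F \<subseteq> I \<and> \<not> F \<subseteq> {0} \<and> x \<in> vc (D_span D F)"
  then obtain F where F: "finite F" "F \<subseteq> I" "\<not> F \<subseteq> {0}" "x \<in> vc (D_span D F)" by blast
  then have "D_span D F \<subseteq> I" "D_span D F \<noteq> {0}"
    using span_least[OF assms] span_eq_zero_iff[of F] by auto
  then show "x \<in> tc I"
    unfolding t_closure_def using F by (intro UnionI[of "vc (D_span D F)"]) auto
qed

lemma tc_mono: "submod I \<Longrightarrow> submod J \<Longrightarrow> I \<subseteq> J \<Longrightarrow> tc I \<subseteq> tc J"
  unfolding tc_mem_iff subset_iff[of "tc I"] by (meson order_trans)

lemma tc_subset_vc: assumes "submod I" shows "tc I \<subseteq> vc I"
proof
  fix x assume "x \<in> tc I"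
  then obtain F where "F \<subseteq> I" "x \<in> vc (D_span D F)" by (auto simp: tc_mem_iff[OF assms])
  then show "x \<in> vc I" using vc_mono[OF span_least[OF assms]] by blast
qed

lemma subset_tc: assumes "fideal I" shows "I \<subseteq> tc I"
proof
  fix x assume x: "x \<in> I"
  obtain y where y: "y \<in> I" "y \<noteq> 0" using frac_nonzero[OF assms] .
  \<comment> \<open>The nonzero \<open>y\<close> keeps the generating set admissible when
    \<open>x = 0\<close>.\<close>
  have "x \<in> vc (D_span D {x, y})" using subset_vc span_superset by blast
  then show "x \<in> tc I" unfolding tc_mem_iff[OF frac_submod[OF assms]]
    using x y by (intro exI[of _ "{x, y}"]) auto
qed

text \<open>The family defining the t-closure is directed, which makes the union a submodule.\<close>

lemma tc_finite_subset:
  assumes I: "fideal I" and "finite G" "G \<subseteq> tc I"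
  obtains F where "finite F" "F \<subseteq> I" "\<not> F \<subseteq> {0}" "G \<subseteq> vc (D_span D F)"
proof -
  have "\<exists>F. finite F \<and> F \<subseteq> I \<and> \<not> F \<subseteq> {0} \<and> G \<subseteq> vc (D_span D F)"
    using assms(2,3)
  proof (induction G)
    case empty
    obtain y where "y \<in> I" "y \<noteq> 0" using frac_nonzero[OF I] .
    then show ?case by (intro exI[of _ "{y}"]) auto
  next
    case (insert x G)
    then obtain F where F: "finite F" "F \<subseteq> I" "\<not> F \<subseteq> {0}" "G \<subseteq> vc (D_span D F)" by auto
    from insert.prems obtain F' where F': "finite F'" "F' \<subseteq> I" "\<not> F' \<subseteq> {0}" "x \<in> vc (D_span D F')"
      by (auto simp: tc_mem_iff[OF frac_submod[OF I]])
    have "vc (D_span D F) \<subseteq> vc (D_span D (F \<union> F'))" "vc (D_span D F') \<subseteq> vc (D_span D (F \<union> F'))"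
      by (auto intro!: vc_mono span_mono)
    then show ?case using F F' by (intro exI[of _ "F \<union> F'"]) auto
  qed
  then show thesis using that by blast
qed

lemma submod_tc: assumes "fideal I" shows "submod (tc I)"
proof (rule submodI)
  show "0 \<in> tc I" using subset_tc[OF assms] submod_zero[OF frac_submod[OF assms]] by blast
  fix x y assume "x \<in> tc I" "y \<in> tc I"
  then obtain F where "finite F" "F \<subseteq> I" "\<not> F \<subseteq> {0}" "{x, y} \<subseteq> vc (D_span D F)"
    using tc_finite_subset[OF assms, of "{x, y}"] by auto
  then show "x + y \<in> tc I"
    using submod_add[OF submod_vc] by (auto simp: tc_mem_iff[OF frac_submod[OF assms]])
next
  fix d x assume "d \<in> D" "x \<in> tc I"
  then show "d * x \<in> tc I"
    using submod_mult[OF submod_vc] by (auto simp: tc_mem_iff[OF frac_submod[OF assms]])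
qed

lemma frac_vc: "fideal I \<Longrightarrow> fideal (vc I)"
  unfolding v_closure_def by (intro frac_inv)

lemma frac_tc: assumes "fideal I" shows "fideal (tc I)"
proof -
  obtain x where x: "x \<in> I" "x \<noteq> 0" using frac_nonzero[OF assms] .
  obtain d where "d \<in> D" "d \<noteq> 0" "\<And>y. y \<in> vc I \<Longrightarrow> d * y \<in> D"
    using frac_denom[OF frac_vc[OF assms]] by blast
  then show ?thesis
    using x subset_tc[OF assms] tc_subset_vc[OF frac_submod[OF assms]]
    by (intro fracI[of _ x d] submod_tc assms) auto
qed

lemma tc_idem: assumes "fideal I" shows "tc (tc I) = tc I"
proof
  show "tc I \<subseteq> tc (tc I)" by (rule subset_tc[OF frac_tc[OF assms]])
  show "tc (tc I) \<subseteq> tc I"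
  proof
    fix x assume "x \<in> tc (tc I)"
    then obtain G where G: "finite G" "G \<subseteq> tc I" "x \<in> vc (D_span D G)"
      by (auto simp: tc_mem_iff[OF submod_tc[OF assms]])
    then obtain F where F: "finite F" "F \<subseteq> I" "\<not> F \<subseteq> {0}" "G \<subseteq> vc (D_span D F)"
      using tc_finite_subset[OF assms] by metis
    have "vc (D_span D G) \<subseteq> vc (D_span D F)"
      by (intro vc_least span_least submod_vc F vc_vc)
    then show "x \<in> tc I" using F G by (auto simp: tc_mem_iff[OF frac_submod[OF assms]])
  qed
qed

lemma t_ideal_frac: "t_ideal D I \<Longrightarrow> fideal I"
  by (simp add: t_ideal_def)

lemma t_ideal_tc: "fideal I \<Longrightarrow> t_ideal D (tc I)"
  by (simp add: t_ideal_def frac_tc tc_idem)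

lemma t_ideal_v: assumes "fideal I" "vc I = I" shows "t_ideal D I"
  using subset_tc[OF assms(1)] tc_subset_vc[OF frac_submod[OF assms(1)]] assms by (auto simp: t_ideal_def)

lemma t_ideal_D: "t_ideal D D"
  by (rule t_ideal_v[OF frac_D vc_D])

lemma tc_D: "tc D = D"
  using t_ideal_D by (simp add: t_ideal_def)

lemma t_ideal_inv: "fideal I \<Longrightarrow> t_ideal D (inv_ideal I)"
  by (rule t_ideal_v) (auto simp: frac_inv vc_inv)

lemma tc_least: "fideal I \<Longrightarrow> t_ideal D J \<Longrightarrow> I \<subseteq> J \<Longrightarrow> tc I \<subseteq> J"
  using tc_mono[of I J] frac_submod by (auto simp: t_ideal_def)

lemma tc_mult_tc: assumes I: "fideal I" and J: "fideal J" shows "tc (tc I \<odot> J) = tc (I \<odot> J)"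
proof
  note IJ = frac_mult[OF I J]
  show "tc (I \<odot> J) \<subseteq> tc (tc I \<odot> J)"
    by (intro tc_mono submod_ideal_mult ideal_mult_mono subset_tc I order_refl)
  have "x * y \<in> tc (I \<odot> J)" if x: "x \<in> tc I" and y: "y \<in> J" for x y
  proof (cases "y = 0")
    case True then show ?thesis using submod_zero[OF submod_tc[OF IJ]] by simp
  next
    case False
    \<comment> \<open>Scaling a finite witness for \<open>x\<close> by \<open>y\<close> gives a
      witness for the product; it still contains a nonzero element because \<open>y\<close> is
      nonzero.\<close>
    obtain F where F: "finite F" "F \<subseteq> I" "\<not> F \<subseteq> {0}" "x \<in> vc (D_span D F)"
      using x by (auto simp: tc_mem_iff[OF frac_submod[OF I]])
    have "y * x \<in> vc (D_span D ((*) y ` F))"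
      using vc_image_mult[of y "D_span D F"] F(4) by (auto simp: span_image_mult)
    moreover have "(*) y ` F \<subseteq> I \<odot> J" using F(2) y by (auto simp: mult.commute intro!: ideal_mult_mem)
    moreover have "\<not> (*) y ` F \<subseteq> {0}" using F(3) False by auto
    ultimately show ?thesis
      using F(1) by (subst tc_mem_iff[OF submod_ideal_mult]) (auto simp: mult.commute intro!: exI[of _ "(*) y ` F"])
  qed
  then have "tc I \<odot> J \<subseteq> tc (I \<odot> J)"
    by (simp add: ideal_mult_subset_iff[OF submod_tc[OF IJ]])
  then show "tc (tc I \<odot> J) \<subseteq> tc (I \<odot> J)"
    by (intro tc_least frac_mult frac_tc I J t_ideal_tc)
qed

lemma tc_mult_tc_right: "fideal I \<Longrightarrow> fideal J \<Longrightarrow> tc (I \<odot> tc J) = tc (I \<odot> J)"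
  using tc_mult_tc[of J I] by (simp add: ideal_mult_commute)

lemma t_invertible_frac: "t_invertible D I \<Longrightarrow> fideal I"
  by (simp add: t_invertible_def)

text \<open>Any such \<open>J\<close> is contained in the inverse of \<open>I\<close>, so another
  ideal may serve as witness; for products this is the product of the two inverses.\<close>

lemma t_invertibleI:
  assumes "fideal I" "fideal J" "I \<odot> J \<subseteq> D" "tc (I \<odot> J) = D" shows "t_invertible D I"
proof -
  have "I \<odot> J \<subseteq> I \<odot> inv_ideal I"
    by (intro ideal_mult_mono order_refl) (use assms in \<open>simp add: subset_inv_iff frac_submod ideal_mult_commute\<close>)
  then have "D \<subseteq> tc (I \<odot> inv_ideal I)" using assms(4) tc_mono[OF submod_ideal_mult submod_ideal_mult] by blast
  moreover have "tc (I \<odot> inv_ideal I) \<subseteq> D"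
    by (intro tc_least frac_mult frac_inv assms t_ideal_D mult_inv_subset)
  ultimately show ?thesis using assms by (simp add: t_invertible_def)
qed

lemma t_invertible_inv: assumes "t_invertible D I" shows "t_invertible D (inv_ideal I)"
  using assms mult_inv_subset[of I]
  by (intro t_invertibleI[of _ I]) (auto simp: t_invertible_def ideal_mult_commute frac_inv)

lemma t_invertible_mult:
  assumes "t_invertible D I" "t_invertible D J" shows "t_invertible D (I \<odot> J)"
proof -
  note f = assms[THEN t_invertible_frac]
  let ?I = "inv_ideal I" and ?J = "inv_ideal J"
  have eq: "(I \<odot> J) \<odot> (?I \<odot> ?J) = (I \<odot> ?I) \<odot> (J \<odot> ?J)"
    by (metis ideal_mult_assoc ideal_mult_commute)
  have "(I \<odot> ?I) \<odot> (J \<odot> ?J) \<subseteq> D \<odot> D"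
    by (intro ideal_mult_mono mult_inv_subset)
  moreover have "tc ((I \<odot> ?I) \<odot> (J \<odot> ?J)) = tc (tc (I \<odot> ?I) \<odot> tc (J \<odot> ?J))"
    using f by (simp add: tc_mult_tc tc_mult_tc_right frac_mult frac_inv frac_tc)
  ultimately show ?thesis
    using f assms eq
    by (intro t_invertibleI[of _ "?I \<odot> ?J"]) (auto simp: t_invertible_def frac_mult frac_inv ideal_mult_D submod_D tc_D)
qed

lemma t_invertible_D: "t_invertible D D"
  by (simp add: t_invertible_def frac_D inv_D ideal_mult_D submod_D tc_D)

text \<open>Multiply \<open>vc I\<close> by \<open>D = tc (I \<odot> inv_ideal I)\<close> and
  regroup: \<open>vc I \<odot> inv_ideal I\<close> lies in \<open>D\<close>, so what remains is
  contained in \<open>tc I\<close>.\<close>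

lemma t_invertible_vc: assumes "t_invertible D I" shows "tc I = vc I"
proof
  note f = t_invertible_frac[OF assms]
  show "tc I \<subseteq> vc I" by (rule tc_subset_vc[OF frac_submod[OF f]])
  have "vc I = vc I \<odot> D" by (simp add: ideal_mult_commute ideal_mult_D submod_vc)
  also have "\<dots> \<subseteq> tc (vc I \<odot> tc (I \<odot> inv_ideal I))"
    using assms by (auto simp: t_invertible_def intro!: subset_tc frac_mult frac_vc frac_D)
  also have "\<dots> = tc (vc I \<odot> (I \<odot> inv_ideal I))"
    using f by (simp add: tc_mult_tc_right frac_mult frac_vc frac_inv)
  also have "vc I \<odot> (I \<odot> inv_ideal I) = I \<odot> (vc I \<odot> inv_ideal I)"
    by (metis ideal_mult_assoc ideal_mult_commute)
  also have "tc (I \<odot> (vc I \<odot> inv_ideal I)) \<subseteq> tc (I \<odot> D)"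
    using mult_inv_subset[of "inv_ideal I"]
    by (intro tc_mono submod_ideal_mult ideal_mult_mono order_refl)
       (simp add: v_closure_def ideal_mult_commute[of "inv_ideal I"])
  finally show "vc I \<subseteq> tc I" using f by (simp add: ideal_mult_commute ideal_mult_D frac_submod)
qed

lemma t_invertible_tc: assumes "t_invertible D I" shows "t_invertible D (tc I)"
  using t_invertible_inv[OF t_invertible_inv[OF assms]] t_invertible_vc[OF assms] by (simp add: v_closure_def)

lemma t_invertible_t_ideal_vc: "t_invertible D I \<Longrightarrow> t_ideal D I \<Longrightarrow> vc I = I"
  using t_invertible_vc by (simp add: t_ideal_def)

subsection \<open>Products of comaximal ideals\<close>

lemma frac_ideals_simps [simp]:
  "carrier (frac_ideals D) = {I. fideal I}" "monoid.mult (frac_ideals D) = ideal_mult D" "one (frac_ideals D) = D"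
  by (simp_all add: frac_ideals_def)

sublocale FI: comm_monoid "frac_ideals D"
proof (unfold_locales, goal_cases)
  case (5 I)
  then show ?case using ideal_mult_commute[of I D] by (simp add: ideal_mult_D frac_submod)
next
  case (6 I J)
  show ?case by (simp add: ideal_mult_commute)
qed (auto simp: frac_mult frac_D ideal_mult_assoc ideal_mult_D frac_submod)

abbreviation "integral I \<equiv> fideal I \<and> I \<subseteq> D"

text \<open>Stated through elements, so that sums of ideals never have to be introduced.\<close>

definition comaximal :: "'k set \<Rightarrow> 'k set \<Rightarrow> bool" where
  "comaximal A B \<longleftrightarrow> (\<exists>a\<in>A. \<exists>b\<in>B. a + b = 1)"

lemma comaximal_sym: "comaximal A B \<Longrightarrow> comaximal B A"
  unfolding comaximal_def using add.commute by metis

lemma comaximal_mono: "comaximal A B \<Longrightarrow> A \<subseteq> A' \<Longrightarrow> B \<subseteq> B' \<Longrightarrow> comaximal A' B'"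
  unfolding comaximal_def by blast

lemma integral_mult: assumes "integral I" "integral J" shows "integral (I \<odot> J)"
  using assms ideal_mult_mono[of I D J D] by (auto simp: frac_mult ideal_mult_D submod_D)

lemma comaximal_D: "integral A \<Longrightarrow> comaximal A D"
  unfolding comaximal_def
  using one_mem submod_zero[OF frac_submod] by (intro bexI[of _ 0] bexI[of _ 1]) auto

lemma comaximal_mult:
  assumes A: "integral A" and B: "integral B" and C: "integral C"
    and "comaximal A B" "comaximal A C"
  shows "comaximal A (B \<odot> C)"
proof -
  note sA = frac_submod[OF conjunct1[OF A]]
  obtain a b where 1: "a \<in> A" "b \<in> B" "a + b = 1" using assms by (auto simp: comaximal_def)
  obtain a' c where 2: "a' \<in> A" "c \<in> C" "a' + c = 1" using assms by (auto simp: comaximal_def)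
  \<comment> \<open>This expands \<open>1 = a + b * (a' + c)\<close>.\<close>
  have "a + b * a' \<in> A" using 1 2 B by (intro submod_add[OF sA] submod_mult[OF sA]) auto
  moreover have "b * c \<in> B \<odot> C" using 1 2 by (intro ideal_mult_mem)
  moreover have "(a + b * a') + b * c = 1"
    using 1(3) 2(3) by (simp add: add.assoc flip: distrib_left)
  ultimately show ?thesis unfolding comaximal_def by blast
qed

lemma comaximal_mult_eq_Int:
  assumes A: "integral A" and B: "integral B" and co: "comaximal A B"
  shows "A \<odot> B = A \<inter> B"
proof
  note s = frac_submod[OF conjunct1[OF A]] frac_submod[OF conjunct1[OF B]]
  show "A \<odot> B \<subseteq> A \<inter> B"
    using A B s by (subst ideal_mult_subset_iff) (auto intro: submod_Int submod_mult submod_mult_right)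
  obtain a b where ab: "a \<in> A" "b \<in> B" "a + b = 1" using co by (auto simp: comaximal_def)
  show "A \<inter> B \<subseteq> A \<odot> B"
  proof safe
    fix x assume "x \<in> A" "x \<in> B"
    then have "a * x + x * b \<in> A \<odot> B"
      using ab by (intro submod_add[OF submod_ideal_mult] ideal_mult_mem)
    moreover have "a * x + x * b = x" using ab(3) by (metis distrib_right mult.commute mult_1)
    ultimately show "x \<in> A \<odot> B" by simp
  qed
qed

text \<open>For the harder inclusion split \<open>x = x * a + x * b\<close> with
  \<open>a + b = 1\<close>: then \<open>x * a\<close> lies in the inverse of \<open>B\<close> and
  \<open>x * b\<close> in that of \<open>A\<close>, while 1 lies in both inverses because the ideals
  are integral.\<close>

lemma inv_mult_comaximal:
  assumes A: "integral A" and B: "integral B" and co: "comaximal A B"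
  shows "inv_ideal (A \<odot> B) = inv_ideal A \<odot> inv_ideal B"
proof
  have "(inv_ideal A \<odot> inv_ideal B) \<odot> (A \<odot> B) = (A \<odot> inv_ideal A) \<odot> (B \<odot> inv_ideal B)"
    by (metis ideal_mult_assoc ideal_mult_commute)
  also have "\<dots> \<subseteq> D \<odot> D" by (intro ideal_mult_mono mult_inv_subset)
  finally show "inv_ideal A \<odot> inv_ideal B \<subseteq> inv_ideal (A \<odot> B)"
    by (simp add: subset_inv_iff submod_ideal_mult ideal_mult_D submod_D)
  obtain a b where ab: "a \<in> A" "b \<in> B" "a + b = 1" using co by (auto simp: comaximal_def)
  have 1: "1 \<in> inv_ideal A" "1 \<in> inv_ideal B" using A B by (auto simp: ideal_inv_def)
  show "inv_ideal (A \<odot> B) \<subseteq> inv_ideal A \<odot> inv_ideal B"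
  proof
    fix x assume x: "x \<in> inv_ideal (A \<odot> B)"
    have xab: "x * (u * v) \<in> D" if "u \<in> A" "v \<in> B" for u v
      using inv_mem_mult[OF x ideal_mult_mem[OF that]] .
    have "x * a \<in> inv_ideal B" using xab[OF ab(1)] by (simp add: ideal_inv_def mult.assoc)
    moreover have "x * b \<in> inv_ideal A" using xab[OF _ ab(2)] by (simp add: ideal_inv_def mult_ac)
    ultimately have "1 * (x * a) + (x * b) * 1 \<in> inv_ideal A \<odot> inv_ideal B"
      by (intro submod_add[OF submod_ideal_mult] ideal_mult_mem 1)
    moreover have "1 * (x * a) + (x * b) * 1 = x" using ab(3) by (simp flip: distrib_left)
    ultimately show "x \<in> inv_ideal A \<odot> inv_ideal B" by simp
  qed
qed

abbreviation fpow (infixr "\<^bold>^" 75) where "I \<^bold>^ k \<equiv> I [^]\<^bsub>frac_ideals D\<^esub> (k::nat)"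
lemma frac_pow: "fideal I \<Longrightarrow> fideal (I \<^bold>^ k)"
  using FI.nat_pow_closed[of I k] by simp

abbreviation "fprod A F \<equiv> finprod (frac_ideals D) A F"

lemma integral_pow: "integral P \<Longrightarrow> integral (P \<^bold>^ k)"
proof (induction k)
  case (Suc k)
  then show ?case using integral_mult[of "P \<^bold>^ k" P] by simp
qed (simp add: frac_D)

lemma comaximal_pow:
  assumes "integral A" "integral B" "comaximal A B" shows "comaximal A (B \<^bold>^ k)"
proof (induction k)
  case (Suc k)
  then show ?case using comaximal_mult[OF assms(1) integral_pow[OF assms(2)] assms(2)] assms by simp
qed (use assms in \<open>simp add: comaximal_D\<close>)

lemma comaximal_pow_pow:
  assumes "integral A" "integral B" "comaximal A B" shows "comaximal (A \<^bold>^ j) (B \<^bold>^ k)"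
  by (meson assms comaximal_pow comaximal_sym integral_pow)

lemma fprod_insert:
  "finite F \<Longrightarrow> P \<notin> F \<Longrightarrow> (\<And>Q. Q \<in> insert P F \<Longrightarrow> fideal (A Q)) \<Longrightarrow> fprod A (insert P F) = A P \<odot> fprod A F"
  by (subst FI.finprod_insert) auto

lemma integral_fprod:
  assumes "finite F" "\<And>P. P \<in> F \<Longrightarrow> integral (A P)" shows "integral (fprod A F)"
  using assms
proof (induction F)
  case (insert P F)
  then show ?case using integral_mult[of "A P" "fprod A F"] by (simp add: fprod_insert)
qed (simp add: frac_D)

lemma comaximal_fprod:
  assumes "finite F" "\<And>P. P \<in> F \<Longrightarrow> integral (A P)" "integral B" "\<And>P. P \<in> F \<Longrightarrow> comaximal B (A P)"
  shows "comaximal B (fprod A F)"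
  using assms
proof (induction F)
  case (insert P F)
  then show ?case using comaximal_mult[of B "A P" "fprod A F"] integral_fprod[of F A]
    by (simp add: fprod_insert)
qed (simp add: comaximal_D)

text \<open>A family rather than a set of ideals, because distinct indices may carry the same ideal:
  all zeroth powers equal \<open>D\<close>.\<close>

definition comaximal_family :: "('b \<Rightarrow> 'k set) \<Rightarrow> 'b set \<Rightarrow> bool" where
  "comaximal_family A F \<longleftrightarrow>
     finite F \<and> (\<forall>P\<in>F. integral (A P)) \<and> (\<forall>P\<in>F. \<forall>Q\<in>F. P \<noteq> Q \<longrightarrow> comaximal (A P) (A Q))"

lemma comaximal_family_integral: "comaximal_family A F \<Longrightarrow> P \<in> F \<Longrightarrow> integral (A P)"
  by (simp add: comaximal_family_def)

lemma comaximal_family_insertD: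
  assumes "comaximal_family A (insert P F)" "P \<notin> F"
  shows "comaximal_family A F" "integral (A P)" "integral (fprod A F)" "comaximal (A P) (fprod A F)"
    "finite F" "fprod A (insert P F) = A P \<odot> fprod A F"
proof -
  show fam: "comaximal_family A F" and int: "integral (A P)" and fin: "finite F"
    using assms by (auto simp: comaximal_family_def)
  show "integral (fprod A F)" using fam fin by (intro integral_fprod) (auto simp: comaximal_family_def)
  show "comaximal (A P) (fprod A F)"
    using assms by (intro comaximal_fprod) (auto simp: comaximal_family_def)
  show "fprod A (insert P F) = A P \<odot> fprod A F"
    using assms by (intro fprod_insert) (auto simp: comaximal_family_def)
qed

lemma comaximal_fprod_eq_Int: "comaximal_family A F \<Longrightarrow> fprod A F = D \<inter> \<Inter>(A ` F)"
proof (induction F rule: infinite_finite_induct)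
  case (insert P F)
  note fam = comaximal_family_insertD[OF insert.prems insert.hyps(2)]
  show ?case
    using insert.IH[OF fam(1)] comaximal_mult_eq_Int[OF fam(2,3,4)] fam(6) by auto
qed (auto simp: comaximal_family_def)

lemma inv_comaximal_fprod: "comaximal_family A F \<Longrightarrow> inv_ideal (fprod A F) = fprod (\<lambda>P. inv_ideal (A P)) F"
proof (induction F rule: infinite_finite_induct)
  case (insert P F)
  note fam = comaximal_family_insertD[OF insert.prems insert.hyps(2)]
  have "fprod (\<lambda>P. inv_ideal (A P)) (insert P F) = inv_ideal (A P) \<odot> fprod (\<lambda>P. inv_ideal (A P)) F"
    using insert.prems insert.hyps by (intro fprod_insert) (auto simp: comaximal_family_def frac_inv)
  then show ?case
    using insert.IH[OF fam(1)] inv_mult_comaximal[OF fam(2,3,4)] fam(6) by simp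
qed (auto simp: comaximal_family_def inv_D)

lemma comaximal_family_vc:
  assumes "comaximal_family A F" shows "comaximal_family (\<lambda>P. vc (A P)) F"
proof -
  have "vc (A P) \<subseteq> D" if "P \<in> F" for P
    using assms that by (intro vc_least) (auto simp: comaximal_family_def vc_D)
  then show ?thesis
    using assms unfolding comaximal_family_def
    by (auto intro: frac_vc comaximal_mono[OF _ subset_vc subset_vc])
qed

lemma vc_Inter: "(\<And>I. I \<in> X \<Longrightarrow> vc I = I) \<Longrightarrow> vc (D \<inter> \<Inter>X) = D \<inter> \<Inter>X"
proof (rule equalityI[OF _ subset_vc])
  assume X: "\<And>I. I \<in> X \<Longrightarrow> vc I = I"
  have "vc (D \<inter> \<Inter>X) \<subseteq> I" if "I \<in> insert D X" for I
    using that X vc_D by (intro vc_least) auto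
  then show "vc (D \<inter> \<Inter>X) \<subseteq> D \<inter> \<Inter>X" by blast
qed

text \<open>Both products have the same inverse, hence the same v-closure, and the right-hand side
  is its own v-closure, being an intersection of v-closed ideals.\<close>

lemma vc_comaximal_fprod:
  assumes "comaximal_family A F" shows "vc (fprod A F) = fprod (\<lambda>P. vc (A P)) F"
proof -
  note v = comaximal_family_vc[OF assms]
  have "inv_ideal (fprod (\<lambda>P. vc (A P)) F) = fprod (\<lambda>P. inv_ideal (A P)) F"
    using inv_comaximal_fprod[OF v] by (simp add: inv_vc)
  then have "vc (fprod (\<lambda>P. vc (A P)) F) = vc (fprod A F)"
    unfolding v_closure_def[of D "fprod _ _"] using inv_comaximal_fprod[OF assms] by simp
  moreover have "vc (fprod (\<lambda>P. vc (A P)) F) = fprod (\<lambda>P. vc (A P)) F"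
    unfolding comaximal_fprod_eq_Int[OF v] by (rule vc_Inter) (auto simp: vc_vc)
  ultimately show ?thesis by simp
qed

lemma t_invertible_pow: "t_invertible D P \<Longrightarrow> t_invertible D (P \<^bold>^ k)"
  by (induction k) (auto simp: t_invertible_D t_invertible_mult)

lemma t_invertible_fprod:
  assumes "finite F" "\<And>P. P \<in> F \<Longrightarrow> t_invertible D (A P)" shows "t_invertible D (fprod A F)"
  using assms
  by (induction F) (auto simp: t_invertible_D t_invertible_mult fprod_insert t_invertible_frac)

lemma fprod_pow:
  assumes "finite F" "\<And>P. P \<in> F \<Longrightarrow> fideal (A P)" shows "fprod A F \<^bold>^ k = fprod (\<lambda>P. A P \<^bold>^ k) F"
proof (induction k)
  case 0
  then show ?case by (simp add: FI.finprod_one_eqI)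
next
  case (Suc k)
  have "fprod (\<lambda>P. A P \<^bold>^ Suc k) F = fprod (\<lambda>P. A P \<^bold>^ k \<odot> A P) F"
    using assms by (intro FI.finprod_cong') (auto intro!: frac_mult frac_pow)
  also have "\<dots> = fprod (\<lambda>P. A P \<^bold>^ k) F \<odot> fprod A F"
    using assms FI.finprod_multf[of "\<lambda>P. A P \<^bold>^ k" F A] by (auto simp: frac_pow)
  finally show ?case using Suc by simp
qed

subsection \<open>t-maximal ideals\<close>

lemma t_Max_t_ideal: "P \<in> t_Max D \<Longrightarrow> t_ideal D P"
  and t_Max_subset: "P \<in> t_Max D \<Longrightarrow> P \<subseteq> D"
  and t_Max_integral: "P \<in> t_Max D \<Longrightarrow> integral P"
  and t_Max_submod: "P \<in> t_Max D \<Longrightarrow> submod P"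
  by (auto simp: t_Max_def t_ideal_def frac_submod)

lemma t_Max_maximal: "P \<in> t_Max D \<Longrightarrow> t_ideal D Q \<Longrightarrow> Q \<subset> D \<Longrightarrow> P \<subseteq> Q \<Longrightarrow> Q = P"
  by (auto simp: t_Max_def)

lemma one_mem_ideal: "submod I \<Longrightarrow> 1 \<in> I \<Longrightarrow> D \<subseteq> I"
  using submod_mult[of I _ 1] by auto

lemma t_Max_one: "P \<in> t_Max D \<Longrightarrow> 1 \<notin> P"
  using one_mem_ideal[OF t_Max_submod] by (auto simp: t_Max_def)

lemma t_Max_zero: "P \<in> t_Max D \<Longrightarrow> 0 \<in> P"
  by (simp add: t_Max_submod submod_zero)

text \<open>The colon ideal of \<open>P\<close> by \<open>a\<close> is again a t-ideal, so by maximality it is \<open>P\<close> or \<open>D\<close>.\<close>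

lemma t_Max_prime:
  assumes P: "P \<in> t_Max D" and "a \<in> D" "b \<in> D" "a * b \<in> P" shows "a \<in> P \<or> b \<in> P"
proof (rule ccontr)
  assume n: "\<not> (a \<in> P \<or> b \<in> P)"
  then have "a \<noteq> 0" using t_Max_zero[OF P] by auto
  define J where "J = {x \<in> D. \<forall>y\<in>{a}. x * y \<in> P}"
  have J: "J = D \<inter> {x. \<forall>y\<in>{a}. x * y \<in> P}" by (auto simp: J_def)
  have PJ: "P \<subseteq> J" using t_Max_subset[OF P] assms(2) submod_mult_right[OF t_Max_submod[OF P]] by (auto simp: J_def)
  have sub: "submod J" unfolding J by (intro submod_Int submod_D submod_colon t_Max_submod P)
  obtain x where x: "x \<in> P" "x \<noteq> 0" using frac_nonzero t_ideal_frac t_Max_t_ideal[OF P] by metis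
  have f: "fideal J" using sub x PJ by (intro frac_integral[of J x]) (auto simp: J_def)
  have "tc J \<subseteq> D" by (rule tc_least[OF f t_ideal_D]) (auto simp: J_def)
  \<comment> \<open>Multiplication by \<open>a\<close> carries a finite set in \<open>J\<close> into
    \<open>P\<close>, so it carries the t-closure of \<open>J\<close> into that of \<open>P\<close>,
    which is \<open>P\<close>. This makes \<open>J\<close> t-closed.\<close>
  moreover have "(*) a ` tc J \<subseteq> P"
  proof safe
    fix x assume "x \<in> tc J"
    then obtain F where F: "finite F" "F \<subseteq> J" "\<not> F \<subseteq> {0}" "x \<in> vc (D_span D F)"
      by (auto simp: tc_mem_iff[OF sub])
    have "a * x \<in> vc (D_span D ((*) a ` F))"
      using vc_image_mult[of a "D_span D F"] F(4) by (auto simp: span_image_mult)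
    moreover have "(*) a ` F \<subseteq> P" using F(2) by (auto simp: J_def mult.commute)
    moreover have "\<not> (*) a ` F \<subseteq> {0}" using F(3) \<open>a \<noteq> 0\<close> by auto
    ultimately have "a * x \<in> tc P"
      unfolding tc_mem_iff[OF t_Max_submod[OF P]] using F(1) by blast
    then show "a * x \<in> P" using t_Max_t_ideal[OF P] by (simp add: t_ideal_def)
  qed
  ultimately have "tc J \<subseteq> J" by (auto simp: J_def mult.commute)
  then have "t_ideal D J" using f subset_tc by (auto simp: t_ideal_def)
  moreover have "1 \<notin> J" using n by (simp add: J_def)
  then have "J \<noteq> D" using one_mem by blast
  ultimately have "J = P" using PJ one_mem by (intro t_Max_maximal[OF P]) (auto simp: J)
  moreover have "b \<in> J" using assms by (simp add: J_def mult.commute)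
  ultimately show False using n by blast
qed

lemma t_Max_prod:
  assumes P: "P \<in> t_Max D" and "finite A" "\<And>i. i \<in> A \<Longrightarrow> f i \<in> D - P" shows "prod f A \<in> D - P"
  using assms(2,3) by (induction A) (use t_Max_one[OF P] one_mem t_Max_prime[OF P] in \<open>auto intro: mult_mem\<close>)

lemma t_Max_power: "P \<in> t_Max D \<Longrightarrow> a \<in> D - P \<Longrightarrow> a ^ k \<in> D - P"
  using t_Max_prod[of P "{..<k}" "\<lambda>_. a"] by simp

text \<open>Zorn's lemma applies because the t-closure has finite character: a finite subset of the
  union of a chain already lies in one member, so the union is again t-closed.\<close>

lemma t_Max_exists:
  assumes "t_ideal D I" "I \<subset> D" obtains P where "P \<in> t_Max D" "I \<subseteq> P"
proof -
  define \<C> where "\<C> = {J. t_ideal D J \<and> J \<subset> D \<and> I \<subseteq> J}"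
  have "\<exists>M\<in>\<C>. \<forall>X\<in>\<C>. M \<subseteq> X \<longrightarrow> X = M"
  proof (rule subset_Zorn_nonempty)
    show "\<C> \<noteq> {}" using assms by (auto simp: \<C>_def)
    fix C assume C: "C \<noteq> {}" "subset.chain \<C> C"
    then have CC: "C \<subseteq> \<C>" by (simp add: subset.chain_def)
    have t: "t_ideal D J" "submod J" "1 \<notin> J" "J \<subseteq> D" "I \<subseteq> J" if "J \<in> C" for J
      using that CC one_mem_ideal[of J] by (auto simp: \<C>_def t_ideal_def frac_submod)
    have fin: "\<exists>J\<in>C. F \<subseteq> J" if "finite F" "F \<subseteq> \<Union>C" for F
      using finite_subset_Union_chain[OF that C] by blast
    have sub: "submod (\<Union>C)"
    proof (rule submodI)
      show "0 \<in> \<Union>C" using C(1) t(2) submod_zero by blast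
      show "x + y \<in> \<Union>C" if "x \<in> \<Union>C" "y \<in> \<Union>C" for x y
        using fin[of "{x, y}"] that t(2) submod_add[of _ x y] by blast
      show "d * x \<in> \<Union>C" if "d \<in> D" "x \<in> \<Union>C" for d x
        using that t(2) submod_mult by blast
    qed
    obtain x where "x \<in> I" "x \<noteq> 0" using assms(1) frac_nonzero t_ideal_frac by metis
    then have f: "fideal (\<Union>C)" using sub C(1) t by (intro frac_integral[of _ x]) blast+
    have "tc (\<Union>C) \<subseteq> \<Union>C"
    proof
      fix x assume "x \<in> tc (\<Union>C)"
      then obtain F where F: "finite F" "F \<subseteq> \<Union>C" "\<not> F \<subseteq> {0}" "x \<in> vc (D_span D F)"
        by (auto simp: tc_mem_iff[OF sub])
      obtain J where J: "J \<in> C" "F \<subseteq> J" using fin[OF F(1,2)] by blast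
      have "x \<in> tc J" using F J unfolding tc_mem_iff[OF t(2)[OF J(1)]] by blast
      then show "x \<in> \<Union>C" using t(1)[OF J(1)] J(1) by (auto simp: t_ideal_def)
    qed
    then have "t_ideal D (\<Union>C)" using f subset_tc by (auto simp: t_ideal_def)
    moreover have "\<Union>C \<subset> D" using t one_mem by blast
    moreover have "I \<subseteq> \<Union>C" using t C(1) by blast
    ultimately show "\<Union>C \<in> \<C>" by (simp add: \<C>_def)
  qed
  then obtain M where "M \<in> \<C>" "\<And>X. X \<in> \<C> \<Longrightarrow> M \<subseteq> X \<Longrightarrow> X = M" by blast
  then have "M \<in> t_Max D" "I \<subseteq> M" unfolding \<C>_def t_Max_def by blast+
  then show thesis by (rule that)
qed

text \<open>The denominators of \<open>x\<close> form the ideal \<open>inv_ideal {1, x}\<close>. As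
  an inverse it is v-closed, hence a t-ideal, so if proper it would lie in some t-maximal ideal,
  contrary to the assumption.\<close>

lemma mem_D_if_locally:
  assumes "\<And>P. P \<in> t_Max D \<Longrightarrow> \<exists>s \<in> D - P. s * x \<in> D" shows "x \<in> D"
proof (rule ccontr)
  assume "x \<notin> D"
  define I where "I = inv_ideal {1, x}"
  have mem: "s \<in> I \<longleftrightarrow> s \<in> D \<and> s * x \<in> D" for s by (auto simp: I_def ideal_inv_def)
  obtain a b where ab: "a \<in> D" "b \<in> D" "b \<noteq> 0" "x = a / b" using quotient by metis
  have "fideal I" using ab mem by (intro frac_integral[of I b]) (auto simp: I_def submod_inv)
  then have "t_ideal D I" unfolding I_def by (rule t_ideal_v) (rule vc_inv)
  moreover have "1 \<notin> I" using mem[of 1] \<open>x \<notin> D\<close> by simp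
  then have "I \<subset> D" using mem one_mem by blast
  ultimately obtain P where "P \<in> t_Max D" "I \<subseteq> P" using t_Max_exists by metis
  then show False using assms mem by blast
qed

subsection \<open>Residues modulo t-maximal ideals\<close>

lemma coset_eq_iff:
  assumes "submod P" shows "(+) x ` P = (+) y ` P \<longleftrightarrow> x - y \<in> P"
proof
  assume "(+) x ` P = (+) y ` P"
  moreover have "x \<in> (+) x ` P" using submod_zero[OF assms] by force
  ultimately obtain p where "p \<in> P" "x = y + p" by blast
  then show "x - y \<in> P" by simp
next
  assume xy: "x - y \<in> P"
  have *: "(+) u ` P \<subseteq> (+) v ` P" if "u - v \<in> P" for u v
  proof safe
    fix p assume "p \<in> P"
    then have "u - v + p \<in> P" using that submod_add[OF assms] by blast
    moreover have "u + p = v + (u - v + p)" by simp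
    ultimately show "u + p \<in> (+) v ` P" by (metis imageI)
  qed
  have "y - x \<in> P" using submod_diff[OF assms submod_zero[OF assms] xy] by simp
  then show "(+) x ` P = (+) y ` P" using *[OF xy] * by blast
qed

lemma norm_finite_iff: "ideal_norm D P \<noteq> \<infinity> \<longleftrightarrow> finite ((\<lambda>x. (+) x ` P) ` D)"
  by (simp add: ideal_norm_def Let_def)

text \<open>The representatives are numbered from 0 to \<open>q - 1\<close> so that
  base-\<open>q\<close> digits can index them.\<close>

lemma norm_residues:
  assumes P: "submod P" and q: "ideal_norm D P = enat q"
  obtains r where "\<And>i. i < q \<Longrightarrow> r i \<in> D" "\<And>x. x \<in> D \<Longrightarrow> \<exists>i<q. x - r i \<in> P"
    "\<And>i j. i < q \<Longrightarrow> j < q \<Longrightarrow> i \<noteq> j \<Longrightarrow> r i - r j \<notin> P"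
proof -
  let ?C = "(\<lambda>x. (+) x ` P) ` D"
  have fin: "finite ?C" "card ?C = q" using q by (auto simp: ideal_norm_def Let_def split: if_splits)
  obtain h where h: "bij_betw h {0..<q} ?C" using ex_bij_betw_nat_finite[OF fin(1)] fin(2) by auto
  have "\<exists>x. x \<in> D \<and> h i = (+) x ` P" if "i < q" for i
    using bij_betwE[OF h] that by fastforce
  then obtain r where r: "\<And>i. i < q \<Longrightarrow> r i \<in> D" "\<And>i. i < q \<Longrightarrow> h i = (+) (r i) ` P" by metis
  show thesis
  proof
    show "r i \<in> D" if "i < q" for i using r that by blast
    show "\<exists>i<q. x - r i \<in> P" if "x \<in> D" for x
    proof -
      have "(+) x ` P \<in> h ` {0..<q}" using h that by (simp add: bij_betw_def)
      then obtain i where "i < q" "(+) x ` P = h i" by auto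
      then show ?thesis using r coset_eq_iff[OF P] by auto
    qed
    show "r i - r j \<notin> P" if "i < q" "j < q" "i \<noteq> j" for i j
      using that r inj_onD[OF bij_betw_imp_inj_on[OF h], of i j] coset_eq_iff[OF P] by auto
  qed
qed

lemma infinite_norm_residues:
  fixes n :: nat
  assumes P: "submod P" and inf: "ideal_norm D P = \<infinity>"
  obtains r where "\<And>i. i < n \<Longrightarrow> r i \<in> D" "\<And>i j. i < n \<Longrightarrow> j < n \<Longrightarrow> i \<noteq> j \<Longrightarrow> r i - r j \<notin> P"
proof -
  have "infinite ((\<lambda>x. (+) x ` P) ` D)" using inf norm_finite_iff by blast
  then obtain C where C: "finite C" "card C = n" "C \<subseteq> (\<lambda>x. (+) x ` P) ` D"
    using infinite_arbitrarily_large by metis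
  obtain h where h: "bij_betw h {0..<n} C" using ex_bij_betw_nat_finite[OF C(1)] C(2) by auto
  have "\<exists>x. x \<in> D \<and> h i = (+) x ` P" if "i < n" for i
    using bij_betwE[OF h] C(3) that by fastforce
  then obtain r where r: "\<And>i. i < n \<Longrightarrow> r i \<in> D" "\<And>i. i < n \<Longrightarrow> h i = (+) (r i) ` P" by metis
  show thesis
  proof
    show "r i - r j \<notin> P" if "i < n" "j < n" "i \<noteq> j" for i j
      using that r inj_onD[OF bij_betw_imp_inj_on[OF h], of i j] coset_eq_iff[OF P] by auto
  qed (use r in auto)
qed

lemma t_Max_norm_gt_1:
  assumes P: "P \<in> t_Max D" and "ideal_norm D P = enat q" shows "1 < q"
proof -
  obtain r where r: "\<And>i. i < q \<Longrightarrow> r i \<in> D" "\<And>x. x \<in> D \<Longrightarrow> \<exists>i<q. x - r i \<in> P"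
    using norm_residues[OF t_Max_submod[OF P] assms(2)] by metis
  obtain i j where ij: "i < q" "1 - r i \<in> P" "j < q" "0 - r j \<in> P" using r(2) one_mem zero_mem by metis
  have "i \<noteq> j"
  proof
    assume "i = j"
    then have "1 \<in> P" using submod_diff[OF t_Max_submod[OF P] ij(2,4)] by simp
    then show False using t_Max_one[OF P] by simp
  qed
  then show ?thesis using ij by linarith
qed

text \<open>The finite domain \<open>D/P\<close> is a field: two powers of \<open>a\<close> agree
  modulo \<open>P\<close>, and cancelling the smaller one by primality exhibits an inverse of
  \<open>a\<close>.\<close>

lemma t_Max_finite_norm_maximal:
  assumes P: "P \<in> t_Max D" and fin: "ideal_norm D P \<noteq> \<infinity>" and a: "a \<in> D - P"
  obtains b where "b \<in> D" "1 - a * b \<in> P"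
proof -
  have "(\<lambda>i. (+) (a ^ i) ` P) ` (UNIV::nat set) \<subseteq> (\<lambda>x. (+) x ` P) ` D"
    using a power_mem by auto
  then have "finite ((\<lambda>i. (+) (a ^ i) ` P) ` (UNIV::nat set))"
    by (rule finite_subset) (use fin norm_finite_iff in simp)
  then have "\<not> inj (\<lambda>i::nat. (+) (a ^ i) ` P)" using finite_imageD infinite_UNIV_nat by metis
  then obtain i j :: nat where "i \<noteq> j" and eq: "(+) (a ^ i) ` P = (+) (a ^ j) ` P"
    unfolding inj_def by auto
  then obtain i j :: nat where ij: "i < j" "a ^ i - a ^ j \<in> P"
    using coset_eq_iff[OF t_Max_submod[OF P]] by (metis linorder_neqE_nat)
  have "a ^ j = a ^ i * (a * a ^ (j - i - 1))"
    using ij(1) by (simp flip: power_Suc power_add)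
  then have "a ^ i * (1 - a * a ^ (j - i - 1)) \<in> P" using ij(2) by (simp add: right_diff_distrib)
  moreover have "a ^ i \<in> D - P" by (rule t_Max_power[OF P a])
  moreover have m: "a ^ (j - i - 1) \<in> D" using a power_mem by blast
  ultimately have "1 - a * a ^ (j - i - 1) \<in> P"
    using t_Max_prime[OF P] a by (meson DiffD1 DiffD2 diff_mem mult_mem one_mem)
  then show thesis using that m by blast
qed

text \<open>By t-maximality some element of \<open>P\<close> lies outside \<open>Q\<close>; it is
  invertible modulo \<open>Q\<close>.\<close>

lemma t_Max_finite_norm_comaximal:
  assumes "P \<in> t_Max D" "Q \<in> t_Max D" "P \<noteq> Q" "ideal_norm D Q \<noteq> \<infinity>" shows "comaximal P Q"
proof -
  have "\<not> P \<subseteq> Q" using assms t_Max_maximal[of P Q] by (auto simp: t_Max_def)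
  then obtain a where a: "a \<in> P" "a \<notin> Q" by blast
  then obtain b where b: "b \<in> D" "1 - a * b \<in> Q"
    using t_Max_finite_norm_maximal[OF assms(2,4)] t_Max_subset[OF assms(1)] by blast
  then show ?thesis
    unfolding comaximal_def using submod_mult_right[OF t_Max_submod[OF assms(1)] a(1) b(1)]
    by (intro bexI[of _ "a * b"] bexI[of _ "1 - a * b"]) auto
qed

text \<open>A t-invertible t-maximal ideal becomes principal after localization: since
  \<open>P P\<^sup>-\<^sup>1\<close> is not contained in \<open>P\<close>, some product \<open>ab\<close> with \<open>a \<in> P\<close>, \<open>b \<in> P\<^sup>-\<^sup>1\<close> lies outside \<open>P\<close>.\<close>

lemma t_Max_locally_principal:
  assumes P: "P \<in> t_Max D" and inv: "t_invertible D P"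
  obtains a s where "a \<in> P" "a \<noteq> 0" "s \<in> D - P" "\<And>x. x \<in> P \<Longrightarrow> \<exists>y\<in>D. s * x = a * y"
proof -
  have "\<not> P \<odot> inv_ideal P \<subseteq> P"
  proof
    assume "P \<odot> inv_ideal P \<subseteq> P"
    then have "tc (P \<odot> inv_ideal P) \<subseteq> P"
      using P by (intro tc_least frac_mult frac_inv) (auto simp: t_Max_t_ideal t_ideal_frac)
    then show False using inv t_Max_one[OF P] one_mem by (auto simp: t_invertible_def)
  qed
  then obtain a b where ab: "a \<in> P" "b \<in> inv_ideal P" "a * b \<notin> P"
    by (auto simp: ideal_mult_subset_iff t_Max_submod[OF P])
  show thesis
  proof
    show "a \<in> P" by fact
    show "a \<noteq> 0" using ab t_Max_zero[OF P] by auto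
    show "a * b \<in> D - P" using ab inv_mem_mult[of b P a] by (simp add: mult.commute)
    show "\<exists>y\<in>D. a * b * x = a * y" if "x \<in> P" for x
      using inv_mem_mult[OF ab(2) that] by (intro bexI[of _ "b * x"]) auto
  qed
qed

end

subsection \<open>Integer-valued polynomials over a local ring with principal maximal ideal\<close>

text \<open>The terms vanish from \<open>i = n\<close> on, since
  \<open>n < 2 ^ Suc i \<le> k ^ Suc i\<close>. Allowing any \<open>N \<ge> n\<close> lets the sums
  for \<open>n\<close> and for \<open>n div k\<close> run over a common range.\<close>

lemma w_exp_eq_sum:
  assumes "1 < k" "n \<le> N" shows "w_exp k n = (\<Sum>i<N. n div k ^ Suc i)"
  unfolding w_exp_def
proof (rule suminf_finite)
  fix i assume "i \<notin> {..<N}"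
  then have "n < 2 ^ Suc i" using assms less_exp[of "Suc i"] by simp
  also have "(2::nat) ^ Suc i \<le> k ^ Suc i" using assms by (intro power_mono) auto
  finally show "n div k ^ Suc i = 0" by simp
qed simp

lemma w_exp_0 [simp]: "1 < k \<Longrightarrow> w_exp k 0 = 0"
  using w_exp_eq_sum[of k 0 0] by simp

text \<open>The inductions over base-\<open>k\<close> digits follow this recursion:
  \<open>n div k\<close> factors each give one power of \<open>p\<close>, and their cofactors pose
  the same problem for \<open>n div k\<close>.\<close>

lemma w_exp_rec:
  assumes "1 < k" shows "w_exp k n = n div k + w_exp k (n div k)"
proof -
  have "w_exp k n = (\<Sum>i<Suc n. n div k ^ Suc i)" using assms by (intro w_exp_eq_sum) auto
  also have "\<dots> = n div k + (\<Sum>i<n. n div k ^ Suc (Suc i))" by (simp add: sum.lessThan_Suc_shift del: sum.lessThan_Suc)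
  also have "(\<Sum>i<n. n div k ^ Suc (Suc i)) = (\<Sum>i<n. (n div k) div k ^ Suc i)"
    by (simp add: div_mult2_eq)
  also have "\<dots> = w_exp k (n div k)" using assms by (intro w_exp_eq_sum[symmetric]) auto
  finally show ?thesis .
qed

lemma w_exp_less: "1 < k \<Longrightarrow> n < k \<Longrightarrow> w_exp k n = 0"
  using w_exp_rec[of k n] by simp

lemma w_exp_self: "1 < k \<Longrightarrow> w_exp k k = 1"
  using w_exp_rec[of k k] w_exp_less[of k 1] by simp

section \<open>Newton interpolation over a subring of a field\<close>

definition node_poly :: "(nat \<Rightarrow> 'k::field) \<Rightarrow> nat \<Rightarrow> 'k poly" where
  "node_poly u n = (\<Prod>j<n. [:- u j, 1:])"

lemma poly_node_poly: "poly (node_poly u n) x = (\<Prod>j<n. x - u j)"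
  by (simp add: node_poly_def poly_prod)

lemma degree_node_poly: "degree (node_poly u n) = n" and coeff_node_poly: "coeff (node_poly u n) n = 1"
proof -
  have "degree (node_poly u n) = n \<and> lead_coeff (node_poly u n) = 1"
  proof (induction n)
    case (Suc n)
    have e: "node_poly u (Suc n) = node_poly u n * [:- u n, 1:]" by (simp add: node_poly_def)
    have "node_poly u n \<noteq> 0" by (auto simp: node_poly_def)
    then have "degree (node_poly u (Suc n)) = Suc n" using Suc by (simp add: e degree_mult_eq del: mult_pCons_right)
    moreover have "lead_coeff (node_poly u (Suc n)) = 1" using Suc unfolding e lead_coeff_mult by auto
    ultimately show ?case by simp
  qed (simp add: node_poly_def)
  then show "degree (node_poly u n) = n" "coeff (node_poly u n) n = 1" by auto
qed

locale field_subring =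
  fixes R :: "'k::field set"
  assumes R_one: "1 \<in> R"
    and R_diff: "\<lbrakk>x \<in> R; y \<in> R\<rbrakk> \<Longrightarrow> x - y \<in> R"
    and R_mult: "\<lbrakk>x \<in> R; y \<in> R\<rbrakk> \<Longrightarrow> x * y \<in> R"
begin

lemma R_zero: "0 \<in> R" using R_diff[OF R_one R_one] by simp
lemma R_add: "x \<in> R \<Longrightarrow> y \<in> R \<Longrightarrow> x + y \<in> R"
  using R_diff[OF _ R_diff[OF R_zero], of x y] by simp
lemma R_sum: "(\<And>i. i \<in> A \<Longrightarrow> f i \<in> R) \<Longrightarrow> sum f A \<in> R"
  by (induction A rule: infinite_finite_induct) (auto simp: R_zero R_add)
lemma R_prod: "(\<And>i. i \<in> A \<Longrightarrow> f i \<in> R) \<Longrightarrow> prod f A \<in> R"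
  by (induction A rule: infinite_finite_induct) (auto simp: R_one R_mult)
definition R_units :: "'k set" where
  "R_units = {x \<in> R. x \<noteq> 0 \<and> inverse x \<in> R}"

lemma R_units_prod: "finite A \<Longrightarrow> (\<And>i. i \<in> A \<Longrightarrow> f i \<in> R_units) \<Longrightarrow> prod f A \<in> R_units"
  by (induction A rule: finite_induct) (auto simp: R_units_def R_one R_mult)

lemma R_units_mult: "x \<in> R_units \<Longrightarrow> y \<in> R_units \<Longrightarrow> x * y \<in> R_units"
  by (auto simp: R_units_def R_mult)

lemma R_units_cancel: "x * e \<in> R \<Longrightarrow> e \<in> R_units \<Longrightarrow> x \<in> R"
  using R_mult[of "x * e" "inverse e"] by (simp add: R_units_def field_simps)

text \<open>The values of the normalized Newton polynomials at the nodes form a triangular matrix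
  over \<open>R\<close> with units on the diagonal, so values in \<open>R\<close> force coordinates
  in \<open>R\<close>. The induction removes the top coefficient, which does not change the values
  at the earlier nodes, and then reads off the top coordinate at the last node. Bounding
  \<open>f\<close> by vanishing coefficients instead of its degree makes \<open>n = 0\<close> mean
  \<open>f = 0\<close>.\<close>

lemma newton_expansion:
  assumes "\<And>k l. k < l \<Longrightarrow> l < n \<Longrightarrow> poly (node_poly u k) (u l) / a k \<in> R"
    and "\<And>k. k < n \<Longrightarrow> a k \<noteq> 0"
    and "\<And>k. k < n \<Longrightarrow> poly (node_poly u k) (u k) / a k \<in> R_units"
    and "\<And>i. n \<le> i \<Longrightarrow> coeff f i = 0"
    and "\<And>l. l < n \<Longrightarrow> poly f (u l) \<in> R"
  shows "\<exists>c. (\<forall>k<n. c k \<in> R) \<and> f = (\<Sum>k<n. smult (c k / a k) (node_poly u k))"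
  using assms
proof (induction n arbitrary: f)
  case 0
  then show ?case by (simp add: poly_eq_iff)
next
  case (Suc n)
  define g where "g = f - smult (coeff f n) (node_poly u n)"
  have cg: "coeff g i = 0" if "n \<le> i" for i
  proof (cases "i = n")
    case False
    then have "coeff (node_poly u n) i = 0" using that by (intro coeff_eq_0) (simp add: degree_node_poly)
    then show ?thesis using Suc.prems(4)[of i] that False by (simp add: g_def)
  qed (simp add: g_def coeff_node_poly)
  have "poly g (u l) \<in> R" if "l < n" for l
  proof -
    have "poly (node_poly u n) (u l) = 0" using that by (auto simp: poly_node_poly)
    then show ?thesis using Suc.prems(5)[of l] that by (simp add: g_def)
  qed
  then obtain c where c: "\<And>k. k < n \<Longrightarrow> c k \<in> R" "g = (\<Sum>k<n. smult (c k / a k) (node_poly u k))"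
    using Suc.IH[OF Suc.prems(1,2,3) cg] by force
  define e where "e = coeff f n * a n"
  have f: "f = g + smult (e / a n) (node_poly u n)"
    using Suc.prems(2)[of n] by (simp add: g_def e_def)
  have "poly g (u n) = (\<Sum>k<n. c k * (poly (node_poly u k) (u n) / a k))"
    by (simp add: c(2) poly_sum)
  also have "\<dots> \<in> R" using Suc.prems(1) c by (intro R_sum R_mult) auto
  finally have "e * (poly (node_poly u n) (u n) / a n) \<in> R"
    using R_diff[OF Suc.prems(5)[of n], of "poly g (u n)"] by (simp add: f)
  then have "e \<in> R" using Suc.prems(3)[of n] R_units_cancel by blast
  then show ?case
    using c f by (intro exI[of _ "c(n := e)"]) (auto simp: less_Suc_eq)
qed

lemma newton_leading_coeff:
  assumes "\<And>k l. k < l \<Longrightarrow> l \<le> n \<Longrightarrow> poly (node_poly u k) (u l) / a k \<in> R"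
    and "\<And>k. k \<le> n \<Longrightarrow> a k \<noteq> 0"
    and "\<And>k. k \<le> n \<Longrightarrow> poly (node_poly u k) (u k) / a k \<in> R_units"
    and "degree f \<le> n"
    and "\<And>l. l \<le> n \<Longrightarrow> poly f (u l) \<in> R"
  shows "coeff f n * a n \<in> R"
proof -
  obtain c where c: "\<And>k. k \<le> n \<Longrightarrow> c k \<in> R" "f = (\<Sum>k<Suc n. smult (c k / a k) (node_poly u k))"
    using newton_expansion[of "Suc n" u a f] assms by (force simp: less_Suc_eq_le coeff_eq_0)
  have "coeff f n = (\<Sum>k<n. c k / a k * coeff (node_poly u k) n) + c n / a n"
    by (subst c(2)) (simp add: coeff_sum coeff_node_poly)
  also have "(\<Sum>k<n. c k / a k * coeff (node_poly u k) n) = 0"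
    by (intro sum.neutral) (auto intro!: coeff_eq_0 simp: degree_node_poly)
  finally show ?thesis using c(1)[of n] assms(2)[of n] by simp
qed

text \<open>Nodes with invertible differences have unit node products, so every normalizing constant
  can be 1. This handles infinite norm, where such nodes exist in any number.\<close>

lemma leading_coeff_distinct_residues:
  assumes "\<And>i. i \<le> n \<Longrightarrow> u i \<in> R" "\<And>i j. i \<le> n \<Longrightarrow> j \<le> n \<Longrightarrow> i \<noteq> j \<Longrightarrow> u i - u j \<in> R_units"
    and "degree f \<le> n" "\<And>l. l \<le> n \<Longrightarrow> poly f (u l) \<in> R"
  shows "coeff f n \<in> R"
proof -
  have "coeff f n * 1 \<in> R"
    by (rule newton_leading_coeff[where u = u and a = "\<lambda>_. 1"])
       (use assms in \<open>auto simp: poly_node_poly intro!: R_prod R_diff R_units_prod\<close>)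
  then show ?thesis by simp
qed

end

text \<open>The base-\<open>q\<close> digits of \<open>n\<close> select representatives of the residues.\<close>

function radix_seq :: "nat \<Rightarrow> (nat \<Rightarrow> 'k::field) \<Rightarrow> 'k \<Rightarrow> nat \<Rightarrow> 'k" where
  "radix_seq q r p n = (if n = 0 \<or> q \<le> 1 then 0 else r (n mod q) + p * radix_seq q r p (n div q))"
  by auto
termination by (relation "measure (\<lambda>(_, _, _, n). n)") auto

declare radix_seq.simps [simp del]

text \<open>Models the localization at a t-maximal ideal of norm \<open>q\<close>, with uniformizer
  \<open>p\<close> and residue representatives \<open>r\<close>. Locality enters through
  \<open>r_unit\<close>, whose differences stay units after adding multiples of \<open>p\<close>;
  \<open>r 0 = 0\<close> makes leading zero digits harmless.\<close>

locale finite_residues = field_subring R for R :: "'k::field set" +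
  fixes p :: 'k and q :: nat and r :: "nat \<Rightarrow> 'k"
  assumes p: "p \<in> R" "p \<noteq> 0" and q: "1 < q"
    and r_zero: "r 0 = 0"
    and r_cover: "x \<in> R \<Longrightarrow> \<exists>i<q. \<exists>y\<in>R. x = r i + p * y"
    and r_mem: "i < q \<Longrightarrow> r i \<in> R"
    and r_unit: "\<lbrakk>i < q; j < q; i \<noteq> j; y \<in> R\<rbrakk> \<Longrightarrow> r i - r j + p * y \<in> R_units"
begin

abbreviation "u \<equiv> radix_seq q r p"

lemma u_rec: "u n = r (n mod q) + p * u (n div q)"
  using q r_zero by (cases "n = 0") (simp_all add: radix_seq.simps[of q r p n] radix_seq.simps[of q r p 0])

lemma u_digit: "i < q \<Longrightarrow> u (i + q * j) = r i + p * u j"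
  by (subst u_rec) simp

lemma u_mem: "u n \<in> R"
proof (induction n rule: less_induct)
  case (less n)
  show ?case
  proof (cases "n = 0")
    case False
    then have "u (n div q) \<in> R" using q less by simp
    then show ?thesis using q by (subst u_rec) (auto intro!: R_add R_mult p r_mem)
  qed (simp add: radix_seq.simps R_zero)
qed

text \<open>If \<open>x = r i + p * x'\<close>, the nodes whose index has last digit
  \<open>i\<close> satisfy \<open>x - u (i + q * j) = p * (x' - u j)\<close>. At least
  \<open>n div q\<close> such indices lie below \<open>n\<close>; they give
  \<open>p ^ (n div q)\<close> times the shorter product for \<open>x'\<close>.\<close>

lemma node_product_divisible:
  assumes "x \<in> R" shows "\<exists>y\<in>R. (\<Prod>j<n. x - u j) = p ^ w_exp q n * y"
  using assms
proof (induction n arbitrary: x rule: less_induct)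
  case (less n)
  show ?case
  proof (cases "n = 0")
    case True
    then show ?thesis using q R_one by simp
  next
    case False
    define m where "m = n div q"
    have m: "m < n" "q * m \<le> n" using False q by (auto simp: m_def)
    obtain i x' where i: "i < q" "x' \<in> R" "x = r i + p * x'" using r_cover[OF less.prems] by blast
    obtain y where y: "y \<in> R" "(\<Prod>j<m. x' - u j) = p ^ w_exp q m * y"
      using less.IH[OF m(1) i(2)] by blast
    \<comment> \<open>One further index below \<open>n\<close> may end in the digit
      \<open>i\<close>; its factor is left in the cofactor, which only has to lie in
      \<open>R\<close>.\<close>
    define T where "T = (\<lambda>j. i + q * j) ` {..<m}"
    have "i + q * j < n" if "j < m" for j
    proof -
      have "i + q * j < q * Suc j" using i by simp
      also have "\<dots> \<le> q * m" using that by (intro mult_left_mono) auto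
      finally show ?thesis using m by linarith
    qed
    then have T: "T \<subseteq> {..<n}" by (auto simp: T_def)
    have inj: "inj_on (\<lambda>j. i + q * j) {..<m}" using q by (auto intro: inj_onI)
    have "(\<Prod>j\<in>T. x - u j) = (\<Prod>j<m. p * (x' - u j))"
      using i by (simp add: T_def prod.reindex[OF inj] u_digit right_diff_distrib)
    also have "\<dots> = p ^ m * (p ^ w_exp q m * y)" by (simp add: prod.distrib y)
    also have "\<dots> = p ^ w_exp q n * y" using w_exp_rec[OF q, of n] by (simp add: m_def power_add)
    finally have "(\<Prod>j<n. x - u j) = p ^ w_exp q n * (y * (\<Prod>j\<in>{..<n} - T. x - u j))"
      using prod.subset_diff[OF T, of "\<lambda>j. x - u j"] by (simp add: mult_ac)
    moreover have "y * (\<Prod>j\<in>{..<n} - T. x - u j) \<in> R"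
      using y less.prems by (intro R_mult R_prod R_diff u_mem) auto
    ultimately show ?thesis by blast
  qed
qed

text \<open>At \<open>x = u n\<close> the indices below \<open>n\<close> with the last digit of
  \<open>n\<close> are exactly the \<open>n div q\<close> ones in \<open>T\<close>. Every other
  difference is a unit, so no further power of \<open>p\<close> appears.\<close>

lemma node_product_exact: "\<exists>e\<in>R_units. (\<Prod>j<n. u n - u j) = p ^ w_exp q n * e"
proof (induction n rule: less_induct)
  case (less n)
  show ?case
  proof (cases "n = 0")
    case True
    then show ?thesis using q R_one by (simp add: R_units_def)
  next
    case False
    define m where "m = n div q"
    define i where "i = n mod q"
    have n: "n = i + q * m" "i < q" "m < n" using False q by (auto simp: m_def i_def)
    obtain e where e: "e \<in> R_units" "(\<Prod>j<m. u m - u j) = p ^ w_exp q m * e"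
      using less.IH[OF n(3)] by blast
    define T where "T = (\<lambda>j. i + q * j) ` {..<m}"
    have T: "T \<subseteq> {..<n}" using q by (auto simp: T_def n(1))
    have inj: "inj_on (\<lambda>j. i + q * j) {..<m}" using q by (auto intro: inj_onI)
    have un: "u n = r i + p * u m" unfolding n(1) by (rule u_digit[OF n(2)])
    have "(\<Prod>j\<in>T. u n - u j) = (\<Prod>j<m. p * (u m - u j))"
      using n(2) by (simp add: T_def prod.reindex[OF inj] u_digit un right_diff_distrib)
    also have "\<dots> = p ^ m * (p ^ w_exp q m * e)" by (simp add: prod.distrib e)
    also have "\<dots> = p ^ w_exp q n * e" using w_exp_rec[OF q, of n] by (simp add: m_def power_add)
    finally have "(\<Prod>j<n. u n - u j) = p ^ w_exp q n * (e * (\<Prod>j\<in>{..<n} - T. u n - u j))"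
      using prod.subset_diff[OF T, of "\<lambda>j. u n - u j"] by (simp add: mult_ac)
    moreover have "u n - u j \<in> R_units" if j: "j \<in> {..<n} - T" for j
    proof -
      have "j mod q \<noteq> i"
      proof
        assume "j mod q = i"
        then have "j = i + q * (j div q)" using mult_div_mod_eq[of q j] by simp
        moreover from this have "j div q < m" using j q by (simp add: n(1)) (metis add_less_cancel_left mult_less_cancel1)
        ultimately show False using j by (auto simp: T_def)
      qed
      then have "r i - r (j mod q) + p * (u m - u (j div q)) \<in> R_units"
        using q n(2) by (intro r_unit R_diff u_mem) auto
      moreover have "u n - u j = r i - r (j mod q) + p * (u m - u (j div q))"
        unfolding un by (subst (2) u_rec) (simp add: algebra_simps)
      ultimately show ?thesis by simp
    qed
    then have "e * (\<Prod>j\<in>{..<n} - T. u n - u j) \<in> R_units"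
      using e by (intro R_units_mult R_units_prod) auto
    ultimately show ?thesis by blast
  qed
qed

lemma extremal_int_poly:
  obtains f where "f \<in> Int_poly R" "degree f \<le> n" "coeff f n = 1 / p ^ w_exp q n"
proof
  let ?f = "smult (1 / p ^ w_exp q n) (node_poly u n)"
  show "?f \<in> Int_poly R"
    using node_product_divisible[of _ n] p by (fastforce simp: Int_poly_def poly_node_poly)
  show "degree ?f \<le> n" "coeff ?f n = 1 / p ^ w_exp q n"
    by (simp_all add: degree_node_poly coeff_node_poly)
qed

lemma leading_coeff_int_poly:
  assumes "f \<in> Int_poly R" "degree f \<le> n" shows "coeff f n * p ^ w_exp q n \<in> R"
proof (rule newton_leading_coeff[where u = u and a = "\<lambda>k. p ^ w_exp q k"])
  show "poly (node_poly u k) (u l) / p ^ w_exp q k \<in> R" for k l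
    using node_product_divisible[OF u_mem, of l k] p by (auto simp: poly_node_poly)
  show "poly (node_poly u k) (u k) / p ^ w_exp q k \<in> R_units" for k
    using node_product_exact[of k] p by (auto simp: poly_node_poly)
  show "poly f (u l) \<in> R" for l using assms u_mem by (simp add: Int_poly_def)
qed (use assms p in auto)

end

context domain_with_quotient_field
begin

subsection \<open>Localization at a t-maximal ideal\<close>

abbreviation "loc Q \<equiv> localization (D - Q) D"

lemma loc_iff: assumes "Q \<in> t_Max D" shows "x \<in> loc Q \<longleftrightarrow> (\<exists>s\<in>D - Q. s * x \<in> D)"
proof -
  have nz: "s \<noteq> 0" if "s \<in> D - Q" for s using that t_Max_zero[OF assms] by auto
  have "x = a / s \<longleftrightarrow> s * x = a" if "s \<in> D - Q" for s a
    using nz[OF that] by (auto simp: field_simps)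
  then have "(\<exists>a s. x = a / s \<and> a \<in> D \<and> s \<in> D - Q) \<longleftrightarrow> (\<exists>s\<in>D - Q. s * x \<in> D)"
    by metis
  then show ?thesis by (simp add: localization_def)
qed

lemma mem_loc: "Q \<in> t_Max D \<Longrightarrow> x \<in> D \<Longrightarrow> x \<in> loc Q"
  using t_Max_one one_mem by (subst loc_iff) (auto intro!: bexI[of _ 1])

lemma multiplicative_subset_t_Max: "Q \<in> t_Max D \<Longrightarrow> multiplicative_subset D (D - Q)"
  using t_Max_one t_Max_zero t_Max_prime one_mem
  by (auto simp: multiplicative_subset_def intro: mult_mem dest: t_Max_prime)

lemma field_subring_loc: assumes Q: "Q \<in> t_Max D" shows "field_subring (loc Q)"
proof
  show "1 \<in> loc Q" by (rule mem_loc[OF Q one_mem])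
  fix x y assume "x \<in> loc Q" "y \<in> loc Q"
  then obtain s t where st: "s \<in> D - Q" "t \<in> D - Q" "s * x \<in> D" "t * y \<in> D" by (auto simp: loc_iff[OF Q])
  have "s * t \<in> D - Q" using st t_Max_prime[OF Q] by (auto intro: mult_mem)
  moreover have "t * (s * x) - s * (t * y) \<in> D" "(s * x) * (t * y) \<in> D"
    using st by (auto intro: diff_mem mult_mem)
  ultimately show "x - y \<in> loc Q" "x * y \<in> loc Q"
    by (auto simp: loc_iff[OF Q] algebra_simps intro!: bexI[of _ "s * t"])
qed

lemma loc_unitI:
  assumes Q: "Q \<in> t_Max D" and "s \<in> D - Q" "s * x \<in> D - Q"
  shows "x \<in> field_subring.R_units (loc Q)"
proof -
  have "x \<noteq> 0" using assms t_Max_zero[OF Q] by auto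
  moreover have "x \<in> loc Q" using assms by (auto simp: loc_iff[OF Q])
  moreover have "inverse x \<in> loc Q"
    using assms \<open>x \<noteq> 0\<close> by (auto simp: loc_iff[OF Q] mult.assoc intro!: bexI[of _ "s * x"])
  ultimately show ?thesis
    by (simp add: field_subring.R_units_def[OF field_subring_loc[OF Q]])
qed

lemma submod_loc: assumes Q: "Q \<in> t_Max D" shows "submod (loc Q)"
proof -
  interpret field_subring "loc Q" by (rule field_subring_loc[OF Q])
  show ?thesis by (rule submodI) (auto simp: R_zero R_add R_mult mem_loc[OF Q])
qed

lemma finite_residues_loc:
  assumes Q: "Q \<in> t_Max D" and q: "ideal_norm D Q = enat q" and inv: "t_invertible D Q"
  obtains p r where "p \<in> Q" "Q \<subseteq> (*) p ` loc Q" "finite_residues (loc Q) p q r"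
proof -
  interpret field_subring "loc Q" by (rule field_subring_loc[OF Q])
  obtain p s0 where p: "p \<in> Q" "p \<noteq> 0" and s0: "s0 \<in> D - Q" "\<And>x. x \<in> Q \<Longrightarrow> \<exists>y\<in>D. s0 * x = p * y"
    using t_Max_locally_principal[OF Q inv] by metis
  obtain r0 where r0: "\<And>i. i < q \<Longrightarrow> r0 i \<in> D" "\<And>x. x \<in> D \<Longrightarrow> \<exists>i<q. x - r0 i \<in> Q"
    "\<And>i j. i < q \<Longrightarrow> j < q \<Longrightarrow> i \<noteq> j \<Longrightarrow> r0 i - r0 j \<notin> Q"
    using norm_residues[OF t_Max_submod[OF Q] q] by metis
  have q1: "1 < q" by (rule t_Max_norm_gt_1[OF Q q])
  \<comment> \<open>The shift achieves \<open>r 0 = 0\<close> without changing differences of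
    representatives.\<close>
  define r where "r = (\<lambda>i. r0 i - r0 0)"
  have Qp: "Q \<subseteq> (*) p ` loc Q"
  proof
    fix x assume "x \<in> Q"
    then obtain y where y: "y \<in> D" "s0 * x = p * y" using s0 by blast
    have "s0 \<noteq> 0" using s0 t_Max_zero[OF Q] by auto
    then have "x = p * (y / s0)" using y by (simp add: field_simps)
    moreover have "y / s0 \<in> loc Q" using y s0 unfolding localization_def by blast
    ultimately show "x \<in> (*) p ` loc Q" by blast
  qed
  have "finite_residues (loc Q) p q r"
  proof unfold_locales
    show "p \<in> loc Q" using p t_Max_subset[OF Q] mem_loc[OF Q] by blast
    show "p \<noteq> 0" "1 < q" "r 0 = 0" using p q1 by (auto simp: r_def)
    show "r i \<in> loc Q" if "i < q" for i
      using that q1 r0 by (auto simp: r_def intro!: mem_loc[OF Q] diff_mem)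
  next
    fix x assume "x \<in> loc Q"
    then obtain s where s: "s \<in> D - Q" "s * x \<in> D" by (auto simp: loc_iff[OF Q])
    then have "s \<noteq> 0" using t_Max_zero[OF Q] by auto
    obtain b where b: "b \<in> D" "1 - s * b \<in> Q"
      using t_Max_finite_norm_maximal[OF Q _ s(1)] q by auto
    \<comment> \<open>As \<open>b\<close> inverts \<open>s\<close> modulo \<open>Q\<close>, the
      element \<open>b * (s * x)\<close> of \<open>D\<close> represents \<open>x\<close>; adding
      \<open>r0 0\<close> compensates the shift in \<open>r\<close>.\<close>
    have "b * (s * x) + r0 0 \<in> D" using b s r0 q1 by (auto intro!: add_mem mult_mem)
    then obtain i where i: "i < q" "b * (s * x) + r0 0 - r0 i \<in> Q" using r0(2) by blast
    have "(1 - s * b) * (s * x) \<in> Q" using b s by (intro submod_mult_right[OF t_Max_submod[OF Q]])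
    then obtain y1 y2 where y: "y1 \<in> loc Q" "(1 - s * b) * (s * x) = p * y1"
        "y2 \<in> loc Q" "b * (s * x) + r0 0 - r0 i = p * y2"
      using Qp i(2) by blast
    have "1 / s \<in> loc Q" using s one_mem by (auto simp: localization_def)
    then have "y1 * (1 / s) + y2 \<in> loc Q" using y by (intro R_add R_mult)
    moreover have "x = r i + p * (y1 * (1 / s) + y2)"
    proof -
      have "x = ((1 - s * b) * (s * x)) / s + (b * (s * x) + r0 0 - r0 i) + r i"
        using \<open>s \<noteq> 0\<close> by (simp add: r_def field_simps)
      then show ?thesis unfolding y(2,4) by (simp add: algebra_simps)
    qed
    ultimately show "\<exists>i<q. \<exists>y\<in>loc Q. x = r i + p * y" using i by blast
  next
    fix i j y assume ij: "i < q" "j < q" "i \<noteq> j" and "y \<in> loc Q"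
    then obtain s where s: "s \<in> D - Q" "s * y \<in> D" by (auto simp: loc_iff[OF Q])
    have d: "r0 i - r0 j \<in> D" using ij r0(1) by (intro diff_mem)
    then have 1: "s * (r0 i - r0 j) \<notin> Q" using t_Max_prime[OF Q _ d, of s] s r0(3)[OF ij] by auto
    have 2: "p * (s * y) \<in> Q" using p s by (intro submod_mult_right[OF t_Max_submod[OF Q]])
    have "s * (r i - r j + p * y) = s * (r0 i - r0 j) + p * (s * y)" by (simp add: r_def algebra_simps)
    moreover have "s * (r0 i - r0 j) + p * (s * y) \<notin> Q" using 1 submod_diff[OF t_Max_submod[OF Q] _ 2, of "s * (r0 i - r0 j) + p * (s * y)"] by auto
    moreover have "s * (r0 i - r0 j) + p * (s * y) \<in> D"
      using add_mem[OF mult_mem[OF _ d] subsetD[OF t_Max_subset[OF Q] 2]] s(1) by blast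
    ultimately show "r i - r j + p * y \<in> R_units" using s by (intro loc_unitI[OF Q s(1)]) simp
  qed
  then show thesis using that p Qp by blast
qed

lemma pow_subset_loc:
  assumes Q: "Q \<in> t_Max D" and p: "Q \<subseteq> (*) p ` loc Q"
  shows "Q \<^bold>^ k \<subseteq> (*) (p ^ k) ` loc Q"
proof (induction k)
  case 0
  then show ?case using mem_loc[OF Q] by auto
next
  case (Suc k)
  interpret field_subring "loc Q" by (rule field_subring_loc[OF Q])
  have "x * y \<in> (*) (p ^ Suc k) ` loc Q" if xy: "x \<in> Q \<^bold>^ k" "y \<in> Q" for x y
  proof -
    obtain u v where "u \<in> loc Q" "x = p ^ k * u" "v \<in> loc Q" "y = p * v" using xy Suc p by blast
    then have "x * y = p ^ Suc k * (u * v)" "u * v \<in> loc Q" by (auto intro: R_mult)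
    then show ?thesis by blast
  qed
  then show ?case
    using submod_image_mult[OF submod_loc[OF Q], of "p ^ Suc k"]
    by (simp add: ideal_mult_subset_iff del: power_Suc)
qed

lemma power_mem_pow: "x \<in> I \<Longrightarrow> x ^ k \<in> I \<^bold>^ k"
  by (induction k) (auto simp: one_mem mult.commute[of x] intro: ideal_mult_mem)

subsection \<open>Characteristic ideals\<close>

lemma submod_char_ideal: "submod (char_ideal D n)"
proof (rule submodI)
  show "0 \<in> char_ideal D n"
    unfolding char_ideal_def by (rule CollectI, rule exI[of _ 0]) (simp add: Int_poly_def zero_mem)
next
  fix x y assume "x \<in> char_ideal D n" "y \<in> char_ideal D n"
  then obtain f g where "x = coeff f n" "y = coeff g n" "f \<in> Int_poly D" "g \<in> Int_poly D" "degree f \<le> n" "degree g \<le> n"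
    by (auto simp: char_ideal_def)
  then show "x + y \<in> char_ideal D n" unfolding char_ideal_def
    by (intro CollectI exI[of _ "f + g"]) (auto simp: Int_poly_def add_mem degree_add_le)
next
  fix d x assume "d \<in> D" "x \<in> char_ideal D n"
  then obtain f where "x = coeff f n" "f \<in> Int_poly D" "degree f \<le> n" by (auto simp: char_ideal_def)
  then show "d * x \<in> char_ideal D n" unfolding char_ideal_def using \<open>d \<in> D\<close>
    by (intro CollectI exI[of _ "smult d f"]) (auto simp: Int_poly_def mult_mem intro: order_trans[OF degree_smult_le])
qed

lemma D_subset_char_ideal: "D \<subseteq> char_ideal D n"
proof
  fix d assume "d \<in> D"
  then show "d \<in> char_ideal D n" unfolding char_ideal_def
    by (intro CollectI exI[of _ "monom d n"]) (auto simp: Int_poly_def poly_monom degree_monom_le intro: mult_mem power_mem)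
qed

end

section \<open>Characteristic ideals under conditions C1, C2 and C5\<close>

locale L_regular_t_domain = domain_with_quotient_field D for D :: "'k::field set" +
  assumes L_regular: "polynomially_L_regular D"
    and finite_norm_le: "finite {P \<in> t_Max D. ideal_norm D P \<le> enat n}"
    and t_Max_t_invertible: "\<lbrakk>P \<in> t_Max D; ideal_norm D P \<noteq> \<infinity>\<rbrakk> \<Longrightarrow> t_invertible D P"
begin

lemma poly_localization_eq: "Q \<in> t_Max D \<Longrightarrow> poly_localization (D - Q) (Int_poly D) = Int_poly (loc Q)"
  using L_regular multiplicative_subset_t_Max by (simp add: polynomially_L_regular_def)

lemma Int_poly_subset_loc: "Q \<in> t_Max D \<Longrightarrow> Int_poly D \<subseteq> Int_poly (loc Q)"
  unfolding poly_localization_eq[symmetric] poly_localization_def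
proof
  fix f assume "Q \<in> t_Max D" "f \<in> Int_poly D"
  then show "f \<in> {smult (1 / s) f |f s. f \<in> Int_poly D \<and> s \<in> D - Q}"
    using t_Max_one one_mem by (intro CollectI exI[of _ f] exI[of _ 1]) auto
qed

definition max_le :: "nat \<Rightarrow> 'k set set" where
  "max_le n = {P \<in> t_Max D. ideal_norm D P \<le> enat n}"

text \<open>Meaningful only at finite norm, since \<open>the_enat\<close> is unspecified at
  \<infinity>.\<close>

definition norm_nat :: "'k set \<Rightarrow> nat" where
  "norm_nat P = the_enat (ideal_norm D P)"

lemma max_leD: assumes "P \<in> max_le n"
  shows "P \<in> t_Max D" "ideal_norm D P = enat (norm_nat P)" "norm_nat P \<le> n" "1 < norm_nat P"
    "integral P" "t_invertible D P" "ideal_norm D P \<noteq> \<infinity>"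
proof -
  show P: "P \<in> t_Max D" and "ideal_norm D P = enat (norm_nat P)" "norm_nat P \<le> n"
    using assms unfolding max_le_def norm_nat_def by (cases "ideal_norm D P"; simp)+
  then show "1 < norm_nat P" "integral P" "ideal_norm D P \<noteq> \<infinity>" "t_invertible D P"
    using t_Max_norm_gt_1 t_Max_integral t_Max_t_invertible by auto
qed

lemma finite_max_le: "finite (max_le n)"
  unfolding max_le_def by (rule finite_norm_le)

lemma comaximal_family_pow:
  assumes "F \<subseteq> max_le n" shows "comaximal_family (\<lambda>P. P \<^bold>^ k P) F"
  unfolding comaximal_family_def
proof (intro conjI ballI impI)
  show "finite F" using assms finite_max_le finite_subset by blast
  fix P assume P: "P \<in> F"
  then show "fideal (P \<^bold>^ k P)" "P \<^bold>^ k P \<subseteq> D" using max_leD(5)[of P n] assms integral_pow by blast+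
  fix Q assume Q: "Q \<in> F" "P \<noteq> Q"
  then have M: "P \<in> max_le n" "Q \<in> max_le n" using P assms by auto
  show "comaximal (P \<^bold>^ k P) (Q \<^bold>^ k Q)"
    using Q(2) M[THEN max_leD(1)] M[THEN max_leD(5)] M[THEN max_leD(7)]
    by (intro comaximal_pow_pow t_Max_finite_norm_comaximal)
qed

definition fact_prod :: "nat \<Rightarrow> 'k set" where
  "fact_prod n = fprod (\<lambda>P. P \<^bold>^ w_exp (norm_nat P) n) (max_le n)"

lemma fact_family: "comaximal_family (\<lambda>P. P \<^bold>^ w_exp (norm_nat P) n) (max_le n)"
  by (rule comaximal_family_pow[OF order_refl])

lemma integral_fact_prod: "integral (fact_prod n)"
  unfolding fact_prod_def using comaximal_family_integral[OF fact_family] finite_max_le by (intro integral_fprod)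

text \<open>If the norm of \<open>Q\<close> is infinite or exceeds \<open>n\<close>, already
  \<open>c\<close> lies in \<open>loc Q\<close> and \<open>y\<close> only has to be integral. If the
  norm is at most \<open>n\<close>, the denominator of \<open>c\<close> is bounded by
  \<open>p ^ w_exp q n\<close>, and \<open>y\<close> supplies that power because
  \<open>fact_prod n\<close> is contained in its factor at \<open>Q\<close>.\<close>

lemma char_ideal_locally_bounded:
  assumes c: "c \<in> char_ideal D n" and y: "y \<in> fact_prod n" and Q: "Q \<in> t_Max D"
  shows "c * y \<in> loc Q"
proof -
  interpret field_subring "loc Q" by (rule field_subring_loc[OF Q])
  obtain f where f: "f \<in> Int_poly (loc Q)" "degree f \<le> n" "c = coeff f n"
    using c Int_poly_subset_loc[OF Q] by (auto simp: char_ideal_def)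
  have yD: "y \<in> loc Q" using y integral_fact_prod mem_loc[OF Q] by blast
  show ?thesis
  proof (cases "ideal_norm D Q")
    case infinity
    obtain r where r: "\<And>i. i < Suc n \<Longrightarrow> r i \<in> D" "\<And>i j. i < Suc n \<Longrightarrow> j < Suc n \<Longrightarrow> i \<noteq> j \<Longrightarrow> r i - r j \<notin> Q"
      using infinite_norm_residues[OF t_Max_submod[OF Q] infinity, of "Suc n"] by metis
    have "coeff f n \<in> loc Q"
    proof (rule leading_coeff_distinct_residues[of n r f])
      show "r i \<in> loc Q" if "i \<le> n" for i using r that mem_loc[OF Q] by auto
      then show "poly f (r i) \<in> loc Q" if "i \<le> n" for i using f that by (auto simp: Int_poly_def)
      show "r i - r j \<in> R_units" if "i \<le> n" "j \<le> n" "i \<noteq> j" for i j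
        using r that by (intro loc_unitI[OF Q, of 1]) (auto simp: one_mem t_Max_one[OF Q] intro: diff_mem)
    qed (rule f(2))
    then show ?thesis using f yD R_mult by simp
  next
    case (enat q)
    obtain p r where p: "p \<in> Q" "Q \<subseteq> (*) p ` loc Q" "finite_residues (loc Q) p q r"
      using finite_residues_loc[OF Q enat] t_Max_t_invertible[OF Q] enat by auto
    have *: "coeff f n * p ^ w_exp q n \<in> loc Q"
      by (rule finite_residues.leading_coeff_int_poly[OF p(3) f(1,2)])
    show ?thesis
    proof (cases "q \<le> n")
      case True
      then have Qn: "Q \<in> max_le n" "norm_nat Q = q" using Q enat by (auto simp: max_le_def norm_nat_def)
      then have "y \<in> Q \<^bold>^ w_exp q n"
        using y unfolding fact_prod_def comaximal_fprod_eq_Int[OF fact_family] by auto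
      then obtain z where "z \<in> loc Q" "y = p ^ w_exp q n * z" using pow_subset_loc[OF Q p(2)] by blast
      then show ?thesis using R_mult[OF *, of z] f(3) by (simp add: mult.assoc)
    next
      case False
      then have "w_exp q n = 0" using t_Max_norm_gt_1[OF Q enat] by (intro w_exp_less) auto
      then show ?thesis using * f(3) yD R_mult by simp
    qed
  qed
qed

lemma char_ideal_upper: "char_ideal D n \<subseteq> inv_ideal (fact_prod n)"
proof -
  have "c * y \<in> D" if "c \<in> char_ideal D n" "y \<in> fact_prod n" for c y
    by (rule mem_D_if_locally) (use char_ideal_locally_bounded[OF that] in \<open>simp add: loc_iff\<close>)
  then show ?thesis by (auto simp: ideal_inv_def)
qed

lemma char_ideal_lower: "inv_ideal (fact_prod n) \<subseteq> char_ideal D n"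
proof
  fix x assume x: "x \<in> inv_ideal (fact_prod n)"
  let ?A = "\<lambda>P. P \<^bold>^ w_exp (norm_nat P) n"
  define C where "C = D \<inter> {d. \<forall>y\<in>{x}. d * y \<in> char_ideal D n}"
  have sub: "submod C" unfolding C_def by (intro submod_Int submod_D submod_colon submod_char_ideal)
  \<comment> \<open>\<open>x\<close> carries \<open>fact_prod n\<close> into \<open>D\<close>, which
    lies in every characteristic ideal.\<close>
  have MC: "fact_prod n \<subseteq> C"
    using x integral_fact_prod D_subset_char_ideal[of n] by (auto simp: C_def ideal_inv_def mult.commute)
  obtain m where "m \<in> fact_prod n" "m \<noteq> 0" using frac_nonzero integral_fact_prod by metis
  then have intC: "integral C" using frac_integral[OF sub _ _ \<open>m \<noteq> 0\<close>] MC by (auto simp: C_def)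
  have "comaximal C P" if P: "P \<in> max_le n" for P
  proof -
    note PM = max_leD[OF P]
    have ins: "max_le n = insert P (max_le n - {P})" using P by blast
    \<comment> \<open>The product of the other factors is comaximal with \<open>P\<close>, so it
      contains an element \<open>y\<close> outside \<open>P\<close>. Then \<open>p ^ ?w * y\<close>
      lies in \<open>fact_prod n\<close>, and \<open>x\<close> carries it into
      \<open>D\<close>.\<close>
    define M' where "M' = fprod ?A (max_le n - {P})"
    have fam: "comaximal_family ?A (insert P (max_le n - {P}))" using fact_family ins by simp
    have fp: "fact_prod n = ?A P \<odot> M'"
      unfolding fact_prod_def M'_def by (subst ins, subst comaximal_family_insertD(6)[OF fam]) auto
    have "integral M'" using comaximal_family_insertD(3)[OF fam] by (simp add: M'_def)
    have "comaximal P M'" unfolding M'_def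
    proof (rule comaximal_fprod)
      fix Q assume Q: "Q \<in> max_le n - {P}"
      then show "integral (?A Q)" using comaximal_family_integral[OF fact_family] by simp
      show "comaximal P (?A Q)" using Q PM max_leD[of Q n]
        by (intro comaximal_pow t_Max_finite_norm_comaximal) blast+
    qed (use finite_max_le PM in auto)
    then obtain a y where y: "a \<in> P" "y \<in> M'" "a + y = 1" by (auto simp: comaximal_def)
    have yP: "y \<notin> P" using y submod_add[OF t_Max_submod[OF PM(1)], of a y] t_Max_one[OF PM(1)] by auto
    obtain p r where p: "p \<in> P" "finite_residues (loc P) p (norm_nat P) r"
      using finite_residues_loc[OF PM(1,2,6)] by metis
    let ?w = "w_exp (norm_nat P) n"
    obtain f where f: "f \<in> Int_poly (loc P)" "degree f \<le> n" "coeff f n = 1 / p ^ ?w"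
      using finite_residues.extremal_int_poly[OF p(2)] by metis
    \<comment> \<open>Polynomial L-regularity supplies a denominator \<open>s\<close> outside
      \<open>P\<close> that turns the extremal local polynomial into one in
      \<open>Int_poly D\<close>.\<close>
    then obtain g s where g: "g \<in> Int_poly D" "s \<in> D - P" "f = smult (1 / s) g"
      unfolding poly_localization_eq[OF PM(1), symmetric] poly_localization_def by blast
    have "s \<noteq> 0" using g t_Max_zero[OF PM(1)] by auto
    then have "degree g \<le> n" "coeff g n = s * (1 / p ^ ?w)" using f g(3) by (auto simp: field_simps)
    then have sp: "s * (1 / p ^ ?w) \<in> char_ideal D n" using g(1) unfolding char_ideal_def by (intro CollectI exI[of _ g]) simp
    have "p ^ ?w * y \<in> fact_prod n" unfolding fp by (intro ideal_mult_mem power_mem_pow p y)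
    then have "x * (p ^ ?w * y) \<in> D" by (rule inv_mem_mult[OF x])
    \<comment> \<open>The powers of \<open>p\<close> cancel, which leaves \<open>y * s\<close> in
      the conductor \<open>C\<close> but outside \<open>P\<close>.\<close>
    then have "x * (p ^ ?w * y) * (s * (1 / p ^ ?w)) \<in> char_ideal D n"
      by (rule submod_mult[OF submod_char_ideal _ sp])
    moreover have "p \<noteq> 0" using finite_residues.p(2)[OF p(2)] .
    ultimately have "y * s * x \<in> char_ideal D n" by (simp add: mult_ac)
    moreover have "y \<in> D" using y \<open>integral M'\<close> by blast
    ultimately have "y * s \<in> C" using g by (auto simp: C_def intro: mult_mem)
    have "y * s \<in> D - P" using t_Max_prime[OF PM(1)] g yP \<open>y \<in> D\<close> by (auto intro: mult_mem)
    then obtain b where b: "b \<in> D" "1 - y * s * b \<in> P" using t_Max_finite_norm_maximal[OF PM(1,7)] by metis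
    show ?thesis unfolding comaximal_def
      using submod_mult_right[OF sub \<open>y * s \<in> C\<close> b(1)] b(2)
      by (intro bexI[of _ "y * s * b"] bexI[of _ "1 - y * s * b"]) auto
  qed
  \<comment> \<open>\<open>C\<close> is comaximal with each factor, hence with
    \<open>fact_prod n\<close>, which it contains; this forces 1 into \<open>C\<close>.\<close>
  then have "comaximal C (?A P)" if "P \<in> max_le n" for P
    using comaximal_pow[OF intC max_leD(5)[OF that]] that by blast
  then have "comaximal C (fact_prod n)"
    unfolding fact_prod_def
    using intC finite_max_le comaximal_family_integral[OF fact_family] by (intro comaximal_fprod)
  then obtain a b where "a \<in> C" "b \<in> fact_prod n" "a + b = 1" by (auto simp: comaximal_def)
  then have "1 \<in> C" using MC submod_add[OF sub, of a b] by auto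
  then show "x \<in> char_ideal D n" by (simp add: C_def)
qed

lemma char_ideal_eq_inv: "char_ideal D n = inv_ideal (fact_prod n)"
  using char_ideal_upper char_ideal_lower by blast

lemma char_ideal_eq_fprod: "char_ideal D n = fprod (\<lambda>P. inv_ideal (P \<^bold>^ w_exp (norm_nat P) n)) (max_le n)"
  unfolding char_ideal_eq_inv fact_prod_def by (rule inv_comaximal_fprod[OF fact_family])

lemma factorial_ideal_eq_vc: "factorial_ideal D n = vc (fact_prod n)"
  by (simp add: factorial_ideal_def char_ideal_eq_inv v_closure_def)

lemma t_invertible_fact_prod: "t_invertible D (fact_prod n)"
  unfolding fact_prod_def using max_leD(6) by (intro t_invertible_fprod finite_max_le t_invertible_pow)

lemma factorial_ideal_eq_tc: "factorial_ideal D n = tc (fact_prod n)"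
  by (simp add: factorial_ideal_eq_vc t_invertible_vc t_invertible_fact_prod)

lemma fprod_cong: "A = B \<Longrightarrow> (\<And>P. P \<in> B \<Longrightarrow> fideal (g P)) \<Longrightarrow> (\<And>P. P \<in> B \<Longrightarrow> f P = g P) \<Longrightarrow> fprod f A = fprod g B"
  by (intro FI.finprod_cong') auto

lemma factorial_ideal_eq_fprod_vc:
  "factorial_ideal D n = fprod (\<lambda>P. vc (P \<^bold>^ w_exp (norm_nat P) n)) (max_le n)"
  unfolding factorial_ideal_eq_vc fact_prod_def by (rule vc_comaximal_fprod[OF fact_family])

lemma factorial_ideal_eq_fprod:
  "factorial_ideal D n = fprod (\<lambda>P. tc (P \<^bold>^ w_exp (norm_nat P) n)) (max_le n)"
  unfolding factorial_ideal_eq_fprod_vc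
  using max_leD(5,6)
  by (intro fprod_cong refl) (auto simp: t_invertible_vc t_invertible_pow intro!: frac_vc frac_pow)

lemma t_char_ideal: "t_ideal D (char_ideal D n)" "t_invertible D (char_ideal D n)"
  unfolding char_ideal_eq_inv
  using integral_fact_prod t_invertible_fact_prod by (auto intro: t_ideal_inv t_invertible_inv)

lemma t_factorial_ideal: "t_ideal D (factorial_ideal D n)" "t_invertible D (factorial_ideal D n)"
  unfolding factorial_ideal_def
  using t_char_ideal by (auto intro: t_ideal_inv t_invertible_inv t_ideal_frac)

lemma char_ideal_eq_inv_factorial: "char_ideal D n = inv_ideal (factorial_ideal D n)"
  unfolding factorial_ideal_eq_vc inv_vc char_ideal_eq_inv ..

section \<open>The ideals \<open>Pi_ideal D q\<close> and grouping by norm\<close>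

definition max_eq :: "nat \<Rightarrow> 'k set set" where
  "max_eq q = {P \<in> t_Max D. ideal_norm D P = enat q}"

lemma max_eq_subset: "q \<le> n \<Longrightarrow> max_eq q \<subseteq> max_le n"
  by (auto simp: max_eq_def max_le_def)

lemma max_eq_norm: "P \<in> max_eq q \<Longrightarrow> norm_nat P = q"
  by (simp add: max_eq_def norm_nat_def)

lemma finite_max_eq: "finite (max_eq q)"
  using finite_subset[OF max_eq_subset[OF order_refl] finite_max_le] .

lemma Pi_ideal_eq_fprod: "Pi_ideal D q = fprod (\<lambda>P. P) (max_eq q)"
proof -
  have "comaximal_family (\<lambda>P. P \<^bold>^ 1) (max_eq q)"
    by (rule comaximal_family_pow[OF max_eq_subset[OF order_refl]])
  moreover have "P \<^bold>^ 1 = P" if "P \<in> max_eq q" for P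
    using max_leD(5)[of P q] that max_eq_subset[of q q] by (auto simp: ideal_mult_D frac_submod)
  ultimately have "comaximal_family (\<lambda>P. P) (max_eq q)" by (simp add: comaximal_family_def)
  then show ?thesis by (simp add: comaximal_fprod_eq_Int Pi_ideal_def max_eq_def)
qed

lemma t_invertible_Pi: "t_invertible D (Pi_ideal D q)"
  unfolding Pi_ideal_eq_fprod
  using max_eq_subset[of q q] max_leD(6) by (intro t_invertible_fprod finite_max_eq) blast

lemma frac_Pi: "fideal (Pi_ideal D q)"
  by (rule t_invertible_frac[OF t_invertible_Pi])

lemma t_ideal_Pi: "t_ideal D (Pi_ideal D q)"
proof (rule t_ideal_v[OF frac_Pi])
  have "vc P = P" if "P \<in> {P \<in> t_Max D. ideal_norm D P = enat q}" for P
    using that by (intro t_invertible_t_ideal_vc t_Max_t_invertible t_Max_t_ideal) auto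
  then show "vc (Pi_ideal D q) = Pi_ideal D q"
    unfolding Pi_ideal_def by (intro vc_Inter)
qed

lemma Pi_ideal_pow: "Pi_ideal D q \<^bold>^ k = fprod (\<lambda>P. P \<^bold>^ k) (max_eq q)"
  unfolding Pi_ideal_eq_fprod using max_leD(5)[of _ q] max_eq_subset[of q q]
  by (intro fprod_pow finite_max_eq) blast

lemma max_le_Union: "max_le n = (\<Union>q\<in>{q. 1 < q \<and> q \<le> n}. max_eq q)"
proof
  show "max_le n \<subseteq> (\<Union>q\<in>{q. 1 < q \<and> q \<le> n}. max_eq q)"
  proof
    fix P assume P: "P \<in> max_le n"
    then show "P \<in> (\<Union>q\<in>{q. 1 < q \<and> q \<le> n}. max_eq q)"
      using max_leD[OF P] by (intro UN_I[of "norm_nat P"]) (auto simp: max_eq_def)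
  qed
  show "(\<Union>q\<in>{q. 1 < q \<and> q \<le> n}. max_eq q) \<subseteq> max_le n" using max_eq_subset by blast
qed

lemma fprod_max_le:
  assumes "\<And>P. P \<in> max_le n \<Longrightarrow> fideal (f P)"
  shows "fprod f (max_le n) = fprod (\<lambda>q. fprod f (max_eq q)) {q. 1 < q \<and> q \<le> n}"
proof -
  have "finite {q. 1 < q \<and> q \<le> n}" by (rule finite_subset[of _ "{..n}"]) auto
  then show ?thesis
    unfolding max_le_Union
  proof (rule FI.finprod_UN_disjoint)
    show "pairwise (\<lambda>i j. disjnt (max_eq i) (max_eq j)) {q. 1 < q \<and> q \<le> n}"
      by (auto simp: pairwise_def disjnt_def max_eq_def)
  qed (use assms max_eq_subset finite_max_eq in auto)
qed

lemma fact_prod_eq: "fact_prod n = fprod (\<lambda>q. Pi_ideal D q \<^bold>^ w_exp q n) {q. 1 < q \<and> q \<le> n}"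
proof -
  have "fact_prod n = fprod (\<lambda>q. fprod (\<lambda>P. P \<^bold>^ w_exp (norm_nat P) n) (max_eq q)) {q. 1 < q \<and> q \<le> n}"
    unfolding fact_prod_def using max_leD(5) by (intro fprod_max_le frac_pow) blast
  also have "\<dots> = fprod (\<lambda>q. Pi_ideal D q \<^bold>^ w_exp q n) {q. 1 < q \<and> q \<le> n}"
  proof (intro fprod_cong refl)
    fix q
    show "fideal (Pi_ideal D q \<^bold>^ w_exp q n)" by (rule frac_pow[OF frac_Pi])
    show "fprod (\<lambda>P. P \<^bold>^ w_exp (norm_nat P) n) (max_eq q) = Pi_ideal D q \<^bold>^ w_exp q n"
      unfolding Pi_ideal_pow using max_leD(5)[of _ q] max_eq_subset[of q q]
      by (intro fprod_cong refl) (auto simp: max_eq_norm intro!: frac_pow)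
  qed
  finally show ?thesis .
qed

text \<open>After grouping by norm it remains to treat one \<open>q\<close>. There t-closure is
  v-closure, because powers of \<open>Pi_ideal D q\<close> are t-invertible, and v-closure passes
  through the comaximal product.\<close>

lemma factorial_ideal_eq_fprod_Pi:
  "factorial_ideal D n = fprod (\<lambda>q. tc (Pi_ideal D q \<^bold>^ w_exp q n)) {q. 1 < q \<and> q \<le> n}"
proof -
  have "factorial_ideal D n =
      fprod (\<lambda>q. fprod (\<lambda>P. vc (P \<^bold>^ w_exp (norm_nat P) n)) (max_eq q)) {q. 1 < q \<and> q \<le> n}"
    unfolding factorial_ideal_eq_fprod_vc using max_leD(5) by (intro fprod_max_le frac_vc frac_pow) blast
  also have "\<dots> = fprod (\<lambda>q. tc (Pi_ideal D q \<^bold>^ w_exp q n)) {q. 1 < q \<and> q \<le> n}"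
  proof (intro fprod_cong refl)
    fix q
    show "fideal (tc (Pi_ideal D q \<^bold>^ w_exp q n))" by (rule frac_tc[OF frac_pow[OF frac_Pi]])
    have "tc (Pi_ideal D q \<^bold>^ w_exp q n) = vc (fprod (\<lambda>P. P \<^bold>^ w_exp q n) (max_eq q))"
      unfolding Pi_ideal_pow[symmetric] by (rule t_invertible_vc[OF t_invertible_pow[OF t_invertible_Pi]])
    also have "\<dots> = fprod (\<lambda>P. vc (P \<^bold>^ w_exp q n)) (max_eq q)"
      by (rule vc_comaximal_fprod[OF comaximal_family_pow[OF max_eq_subset[OF order_refl]]])
    also have "\<dots> = fprod (\<lambda>P. vc (P \<^bold>^ w_exp (norm_nat P) n)) (max_eq q)"
      using max_leD(5)[of _ q] max_eq_subset[of q q]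
      by (intro fprod_cong refl) (auto simp: max_eq_norm intro!: frac_pow frac_vc)
    finally show "fprod (\<lambda>P. vc (P \<^bold>^ w_exp (norm_nat P) n)) (max_eq q) = tc (Pi_ideal D q \<^bold>^ w_exp q n)" by simp
  qed
  finally show ?thesis .
qed

end

lemma primepow_if_unique_prime_divisor:
  fixes n :: nat
  assumes "1 < n" and uniq: "\<And>p p'. prime p \<Longrightarrow> prime p' \<Longrightarrow> p dvd n \<Longrightarrow> p' dvd n \<Longrightarrow> p = p'"
  shows "primepow n"
proof -
  obtain p where p: "prime p" "p dvd n" using prime_factor_nat[of n] assms(1) by auto
  then have f: "prime_factors n = {p}" using uniq assms(1) by (auto simp: prime_factors_dvd)
  have "n = (\<Prod>p\<in>prime_factors n. p ^ multiplicity p n)" using assms(1) by (intro prime_factorization_nat) auto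
  then have "n = p ^ multiplicity p n" by (simp add: f)
  moreover have "multiplicity p n > 0" using p assms(1) by (simp add: prime_multiplicity_gt_zero_iff)
  ultimately show ?thesis using p(1) unfolding primepow_def by blast
qed

context domain_with_quotient_field
begin

subsection \<open>Norms of t-maximal ideals\<close>

lemma of_nat_mem: "of_nat n \<in> D"
  by (induction n) (auto simp: zero_mem one_mem add_mem)

text \<open>Sylow's theorem for the additive group of \<open>D/P\<close> yields an element of order a power of \<open>p\<close>.\<close>

lemma t_Max_prime_power_mem:
  assumes P: "P \<in> t_Max D" and q: "ideal_norm D P = enat q" and p: "prime p" "p dvd q"
  shows "\<exists>a. of_nat (p ^ a) \<in> P"
proof -
  define A where "A = \<lparr>carrier = D, monoid.mult = (+), one = 0 :: 'k\<rparr>"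
  have simps [simp]: "carrier A = D" "monoid.mult A = (+)" "one A = 0" by (simp_all add: A_def)
  note sub = t_Max_submod[OF P]
  interpret A: comm_group A
    by (rule comm_groupI) (auto simp: zero_mem add_mem add_ac intro!: bexI[of _ "- _"] neg_mem)
  have invA: "inv\<^bsub>A\<^esub> x = - x" if "x \<in> D" for x
    using A.inv_equality[of "- x" x] that neg_mem by simp
  have subgroup: "subgroup P A"
  proof (rule A.subgroupI)
    show "P \<subseteq> carrier A" "P \<noteq> {}" using t_Max_subset[OF P] t_Max_zero[OF P] by auto
    show "inv\<^bsub>A\<^esub> a \<in> P" if "a \<in> P" for a
      using that invA[of a] t_Max_subset[OF P] submod_diff[OF sub t_Max_zero[OF P] that] by auto
    show "a \<otimes>\<^bsub>A\<^esub> b \<in> P" if "a \<in> P" "b \<in> P" for a b using submod_add[OF sub that] by simp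
  qed
  then interpret N: normal P A by (rule A.subgroup_imp_normal)
  have coset: "P #>\<^bsub>A\<^esub> x = (+) x ` P" for x by (auto simp: r_coset_def add.commute)
  have carrier: "carrier (A Mod P) = (\<lambda>x. (+) x ` P) ` D"
    by (simp add: carrier_FactGroup coset)
  have fin: "finite (carrier (A Mod P))" and ord: "Coset.order (A Mod P) = q"
    using q unfolding Coset.order_def carrier by (auto simp: ideal_norm_def Let_def split: if_splits)
  interpret Q: comm_group "A Mod P" by (rule A.abelian_FactGroup[OF subgroup])
  have "q \<noteq> 0" using t_Max_norm_gt_1[OF P q] by simp
  define a where "a = multiplicity p q"
  have "a > 0" using p \<open>q \<noteq> 0\<close> by (simp add: a_def prime_multiplicity_gt_zero_iff)
  obtain m where "q = p ^ a * m" using multiplicity_dvd[of p q] by (auto simp: a_def)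
  then obtain H where H: "subgroup H (A Mod P)" "card H = p ^ a"
    using sylow_thm[OF p(1) Q.group_axioms _ fin] ord by metis
  have "1 < p ^ a" using \<open>a > 0\<close> prime_gt_1_nat[OF p(1)] by (intro one_less_power)
  then have "\<not> H \<subseteq> {\<one>\<^bsub>A Mod P\<^esub>}" using H(2) card_mono[of "{\<one>\<^bsub>A Mod P\<^esub>}" H] by fastforce
  then obtain X where X: "X \<in> H" "X \<noteq> \<one>\<^bsub>A Mod P\<^esub>" by blast
  then obtain x where x: "x \<in> D" "X = P #>\<^bsub>A\<^esub> x"
    using subgroup.subset[OF H(1)] by (auto simp: carrier_FactGroup)
  have coset_P: "P #>\<^bsub>A\<^esub> y = P \<longleftrightarrow> y \<in> P" for y
    using coset_eq_iff[OF sub, of y 0] by (simp add: coset image_ident)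
  have "x \<notin> P" using X(2) coset_P by (simp add: x(2))
  interpret H: comm_group "(A Mod P)\<lparr>carrier := H\<rparr>"
  proof (rule group.group_comm_groupI[OF subgroup.subgroup_is_group[OF H(1) Q.group_axioms]])
    fix y z assume "y \<in> carrier ((A Mod P)\<lparr>carrier := H\<rparr>)" "z \<in> carrier ((A Mod P)\<lparr>carrier := H\<rparr>)"
    then show "y \<otimes>\<^bsub>(A Mod P)\<lparr>carrier := H\<rparr>\<^esub> z = z \<otimes>\<^bsub>(A Mod P)\<lparr>carrier := H\<rparr>\<^esub> y"
      using Q.m_comm[of y z] subgroup.mem_carrier[OF H(1)] by simp
  qed
  have "finite H" using H(2) \<open>1 < p ^ a\<close> by (intro card_ge_0_finite) linarith
  have "X [^]\<^bsub>A Mod P\<^esub> (p ^ a) = \<one>\<^bsub>A Mod P\<^esub>"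
    using H.power_order_eq_one[of X] X(1) H(2) \<open>finite H\<close> Q.nat_pow_consistent[of X "p ^ a" H] by simp
  moreover have "X [^]\<^bsub>A Mod P\<^esub> (p ^ a) = P #>\<^bsub>A\<^esub> (x [^]\<^bsub>A\<^esub> (p ^ a))"
    unfolding x(2) by (rule N.FactGroup_pow) (simp add: x)
  ultimately have "x [^]\<^bsub>A\<^esub> (p ^ a) \<in> P" using coset_P by simp
  moreover have "x [^]\<^bsub>A\<^esub> (n::nat) = of_nat n * x" for n by (induction n) (auto simp: algebra_simps)
  ultimately have "of_nat (p ^ a) * x \<in> P" by simp
  \<comment> \<open>Since \<open>x\<close> lies outside \<open>P\<close>, primality puts the integer
    \<open>p ^ a\<close> itself into \<open>P\<close>.\<close>
  then show ?thesis using t_Max_prime[OF P of_nat_mem x(1)] \<open>x \<notin> P\<close> by blast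
qed

text \<open>Two distinct primes dividing \<open>q\<close> would put coprime integers into
  \<open>P\<close>, and hence 1 by Bezout.\<close>

lemma t_Max_norm_primepow:
  assumes P: "P \<in> t_Max D" and q: "ideal_norm D P = enat q" shows "primepow q"
proof (rule primepow_if_unique_prime_divisor)
  show "1 < q" by (rule t_Max_norm_gt_1[OF P q])
  fix p p' assume p: "prime p" "prime p'" "p dvd q" "p' dvd q"
  obtain a b where ab: "of_nat (p ^ a) \<in> P" "of_nat (p' ^ b) \<in> P"
    using t_Max_prime_power_mem[OF P q] p by metis
  show "p = p'"
  proof (rule ccontr)
    assume "p \<noteq> p'"
    then have "coprime (p ^ a) (p' ^ b)" using primes_coprime[OF p(1,2)] by simp
    moreover obtain d x y where "d dvd p ^ a" "d dvd p' ^ b" and d: "p ^ a * x = p' ^ b * y + d"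
      using bezout_add_strong_nat[of "p ^ a" "p' ^ b"] p(1) by (auto simp: prime_gt_0_nat)
    ultimately have xy: "p ^ a * x = p' ^ b * y + 1" using coprime_common_divisor_nat by metis
    have "of_nat (p ^ a) * of_nat x - of_nat (p' ^ b) * of_nat y \<in> P"
      using ab by (intro submod_diff[OF t_Max_submod[OF P]] submod_mult_right[OF t_Max_submod[OF P]] of_nat_mem)
    moreover have "of_nat (p ^ a) * of_nat x = (of_nat (p' ^ b) * of_nat y + 1 :: 'k)"
      using arg_cong[OF xy, of "of_nat :: nat \<Rightarrow> 'k"] by simp
    ultimately show False using t_Max_one[OF P] by simp
  qed
qed

lemma Pi_ideal_not_primepow: "\<not> primepow q \<Longrightarrow> Pi_ideal D q = D"
  using t_Max_norm_primepow by (auto simp: Pi_ideal_def)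

subsection \<open>The t-class group\<close>

abbreviation "TG \<equiv> t_group D"
abbreviation "CG \<equiv> t_class_group D"
abbreviation "princ \<equiv> {I. principal_frac_ideal D I}"

lemma t_group_simps [simp]:
  "carrier TG = {I. t_ideal D I \<and> t_invertible D I}" "monoid.mult TG I J = tc (I \<odot> J)" "one TG = D"
  by (simp_all add: t_group_def)

lemma tc_t_ideal: "t_ideal D I \<Longrightarrow> tc I = I"
  by (simp add: t_ideal_def)

lemma t_group_closed:
  "t_invertible D I \<Longrightarrow> tc I \<in> carrier TG"
  by (simp add: t_ideal_tc t_invertible_frac t_invertible_tc)

lemma inv_mem_t_group: "I \<in> carrier TG \<Longrightarrow> inv_ideal I \<in> carrier TG"
  by (simp add: t_ideal_inv t_ideal_frac t_invertible_inv)

sublocale TG: comm_group TG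
proof (rule comm_groupI)
  show "\<one>\<^bsub>TG\<^esub> \<in> carrier TG" by (simp add: t_ideal_D t_invertible_D)
next
  fix I J assume "I \<in> carrier TG" "J \<in> carrier TG"
  then show "I \<otimes>\<^bsub>TG\<^esub> J \<in> carrier TG"
    using t_group_closed[of "I \<odot> J"] t_invertible_mult[of I J] by simp
  show "I \<otimes>\<^bsub>TG\<^esub> J = J \<otimes>\<^bsub>TG\<^esub> I" by (simp add: ideal_mult_commute)
next
  fix I J K assume "I \<in> carrier TG" "J \<in> carrier TG" "K \<in> carrier TG"
  then show "I \<otimes>\<^bsub>TG\<^esub> J \<otimes>\<^bsub>TG\<^esub> K = I \<otimes>\<^bsub>TG\<^esub> (J \<otimes>\<^bsub>TG\<^esub> K)"
    by (simp add: tc_mult_tc tc_mult_tc_right frac_mult t_invertible_frac ideal_mult_assoc)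
next
  fix I assume "I \<in> carrier TG"
  then show "\<one>\<^bsub>TG\<^esub> \<otimes>\<^bsub>TG\<^esub> I = I"
    by (simp add: ideal_mult_D t_ideal_frac frac_submod tc_t_ideal)
  show "\<exists>J\<in>carrier TG. J \<otimes>\<^bsub>TG\<^esub> I = \<one>\<^bsub>TG\<^esub>"
    using \<open>I \<in> carrier TG\<close> inv_mem_t_group[of I]
    by (intro bexI[of _ "inv_ideal I"]) (auto simp: t_invertible_def ideal_mult_commute)
qed

lemma t_group_inv:
  assumes I: "I \<in> carrier TG" shows "inv\<^bsub>TG\<^esub> I = inv_ideal I"
proof (rule TG.inv_equality[OF _ I inv_mem_t_group[OF I]])
  show "inv_ideal I \<otimes>\<^bsub>TG\<^esub> I = \<one>\<^bsub>TG\<^esub>"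
    using I by (simp add: t_invertible_def ideal_mult_commute)
qed

lemma principal_iff: "principal_frac_ideal D I \<longleftrightarrow> (\<exists>c. c \<noteq> 0 \<and> I = (*) c ` D)"
  by (simp add: principal_frac_ideal_def)

lemma principal_D: "principal_frac_ideal D D"
  unfolding principal_iff by (intro exI[of _ 1]) auto

lemma frac_principal: assumes "c \<noteq> 0" shows "fideal ((*) c ` D)"
proof -
  obtain a b where ab: "a \<in> D" "b \<in> D" "b \<noteq> 0" "c = a / b" using quotient by metis
  show ?thesis
    by (rule fracI[OF submod_image_mult[OF submod_D], of "c * 1" _ b])
       (use ab assms one_mem in \<open>auto intro: mult_mem\<close>)
qed

lemma mult_principal: "(*) c ` D \<odot> (*) e ` D = (*) (c * e) ` D"
proof
  have "submod ((*) (c * e) ` D)" by (rule submod_image_mult[OF submod_D])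
  moreover have "c * x * (e * y) \<in> (*) (c * e) ` D" if "x \<in> D" "y \<in> D" for x y
    by (rule rev_image_eqI[OF mult_mem[OF that]]) (simp add: mult_ac)
  ultimately show "(*) c ` D \<odot> (*) e ` D \<subseteq> (*) (c * e) ` D"
    by (auto simp: ideal_mult_subset_iff)
  show "(*) (c * e) ` D \<subseteq> (*) c ` D \<odot> (*) e ` D"
  proof safe
    fix d assume "d \<in> D"
    then have "(c * d) * (e * 1) \<in> (*) c ` D \<odot> (*) e ` D"
      using one_mem by (intro ideal_mult_mem imageI)
    then show "c * e * d \<in> (*) c ` D \<odot> (*) e ` D" by (simp add: mult_ac)
  qed
qed

lemma inv_principal: assumes "c \<noteq> 0" shows "inv_ideal ((*) c ` D) = (*) (1 / c) ` D"
proof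
  show "(*) (1 / c) ` D \<subseteq> inv_ideal ((*) c ` D)"
    using assms by (auto simp: ideal_inv_def intro: mult_mem)
  show "inv_ideal ((*) c ` D) \<subseteq> (*) (1 / c) ` D"
  proof
    fix x assume "x \<in> inv_ideal ((*) c ` D)"
    then have "x * (c * 1) \<in> D" using one_mem by (rule inv_mem_mult[OF _ imageI])
    then show "x \<in> (*) (1 / c) ` D" using assms by (intro image_eqI[of _ _ "x * c"]) auto
  qed
qed

lemma principal_mem_t_group: "principal_frac_ideal D I \<Longrightarrow> I \<in> carrier TG"
proof -
  assume "principal_frac_ideal D I"
  then obtain c where c: "c \<noteq> 0" "I = (*) c ` D" by (auto simp: principal_iff)
  have f: "fideal I" using c frac_principal by simp
  have "1 / c \<noteq> 0" using c by simp
  then have "vc I = I" unfolding v_closure_def c(2) inv_principal[OF c(1)] by (subst inv_principal) auto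
  moreover have "I \<odot> inv_ideal I = D"
    unfolding c(2) inv_principal[OF c(1)] mult_principal using c(1) by simp
  ultimately show ?thesis using f by (simp add: t_ideal_v t_invertible_def tc_D)
qed

lemma principal_inv: "principal_frac_ideal D I \<Longrightarrow> principal_frac_ideal D (inv_ideal I)"
  by (auto simp: principal_iff inv_principal intro: exI[of _ "1 / _"])

lemma principal_subgroup: "subgroup princ TG"
proof (rule TG.subgroupI)
  show "princ \<subseteq> carrier TG" using principal_mem_t_group by blast
  show "princ \<noteq> {}" using principal_D by blast
  show "inv\<^bsub>TG\<^esub> I \<in> princ" if "I \<in> princ" for I
    using that principal_inv t_group_inv[OF principal_mem_t_group] by simp
  show "I \<otimes>\<^bsub>TG\<^esub> J \<in> princ" if "I \<in> princ" "J \<in> princ" for I J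
  proof -
    have "principal_frac_ideal D (I \<odot> J)"
      using that by (auto simp: principal_iff mult_principal) (metis mult_eq_0_iff)
    then show ?thesis using principal_mem_t_group[of "I \<odot> J"] by (simp add: tc_t_ideal)
  qed
qed

sublocale PN: normal princ TG
  by (rule TG.subgroup_imp_normal[OF principal_subgroup])

sublocale CG: group CG
  unfolding t_class_group_def by (rule PN.factorgroup_is_group)

sublocale CH: group_hom TG CG "t_class D"
proof
  show "t_class D \<in> hom TG CG"
    using PN.r_coset_hom_Mod unfolding t_class_group_def t_class_def .
qed

lemma t_class_one_iff: assumes "I \<in> carrier TG"
  shows "t_class D I = \<one>\<^bsub>CG\<^esub> \<longleftrightarrow> principal_frac_ideal D I"
  unfolding t_class_def t_class_group_def one_FactGroup
  using TG.coset_join1[OF _ assms principal_subgroup] TG.coset_join2[OF assms principal_subgroup]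
    subgroup.subset[OF principal_subgroup] by auto

text \<open>Translates the ordinary products and powers of \<open>frac_ideals D\<close>, which need
  not be t-closed, into the t-class group.\<close>

lemma t_class_mult:
  assumes "t_invertible D I" "t_invertible D J"
  shows "t_class D (tc (I \<odot> J)) = t_class D (tc I) \<otimes>\<^bsub>CG\<^esub> t_class D (tc J)"
proof -
  have "tc (I \<odot> J) = tc I \<otimes>\<^bsub>TG\<^esub> tc J"
    using assms by (simp add: tc_mult_tc tc_mult_tc_right t_invertible_frac frac_tc)
  then show ?thesis using CH.hom_mult[OF assms[THEN t_group_closed]] by simp
qed

lemma t_class_D: "t_class D D = \<one>\<^bsub>CG\<^esub>"
  using CH.hom_one by simp

lemma t_class_pow_mem:
  assumes S: "subgroup S CG" and "t_invertible D I" "t_class D (tc I) \<in> S"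
  shows "t_class D (tc (I \<^bold>^ k)) \<in> S"
  using assms
  by (induction k) (auto simp: tc_D t_class_D t_class_mult t_invertible_pow subgroup.one_closed[OF S] subgroup.m_closed[OF S])

lemma t_class_fprod_mem:
  assumes S: "subgroup S CG" and "finite F"
    and "\<And>P. P \<in> F \<Longrightarrow> t_invertible D (A P)" "\<And>P. P \<in> F \<Longrightarrow> t_class D (tc (A P)) \<in> S"
  shows "t_class D (tc (fprod A F)) \<in> S"
  using assms(2-)
proof (induction F)
  case (insert P F)
  then show ?case
    by (simp add: fprod_insert t_invertible_frac t_class_mult t_invertible_fprod subgroup.m_closed[OF S])
qed (simp add: tc_D t_class_D subgroup.one_closed[OF S])

lemma t_class_inv_mem_iff:
  assumes S: "subgroup S CG" and I: "I \<in> carrier TG"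
  shows "t_class D (inv_ideal I) \<in> S \<longleftrightarrow> t_class D I \<in> S"
  using subgroup.m_inv_closed[OF S] CH.hom_inv[OF I] CG.inv_inv[OF CH.hom_closed[OF I]]
  by (metis t_group_inv[OF I])

lemma subgroup_generate_classes:
  "Y \<subseteq> carrier TG \<Longrightarrow> subgroup (generate CG (t_class D ` Y)) CG"
  by (rule CG.generate_is_subgroup) (use CH.hom_closed in blast)

lemma generate_classes_subset:
  "subgroup S CG \<Longrightarrow> (\<And>I. I \<in> Y \<Longrightarrow> t_class D I \<in> S) \<Longrightarrow> generate CG (t_class D ` Y) \<subseteq> S"
  by (rule CG.generate_subgroup_incl) auto

lemma generate_classes_trivial_iff:
  assumes Y: "Y \<subseteq> carrier TG"
  shows "generate CG (t_class D ` Y) = {\<one>\<^bsub>CG\<^esub>} \<longleftrightarrow> (\<forall>I\<in>Y. principal_frac_ideal D I)"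
proof -
  have "generate CG (t_class D ` Y) = {\<one>\<^bsub>CG\<^esub>} \<longleftrightarrow> (\<forall>I\<in>Y. t_class D I = \<one>\<^bsub>CG\<^esub>)"
  proof
    assume "generate CG (t_class D ` Y) = {\<one>\<^bsub>CG\<^esub>}"
    then show "\<forall>I\<in>Y. t_class D I = \<one>\<^bsub>CG\<^esub>" using generate.incl[of _ "t_class D ` Y" CG] by blast
  next
    assume "\<forall>I\<in>Y. t_class D I = \<one>\<^bsub>CG\<^esub>"
    then have "generate CG (t_class D ` Y) \<subseteq> {\<one>\<^bsub>CG\<^esub>}"
      by (intro generate_classes_subset CG.triv_subgroup) auto
    then show "generate CG (t_class D ` Y) = {\<one>\<^bsub>CG\<^esub>}" using generate.one[of CG] by blast
  qed
  moreover have "t_class D I = \<one>\<^bsub>CG\<^esub> \<longleftrightarrow> principal_frac_ideal D I" if "I \<in> Y" for I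
    by (rule t_class_one_iff[OF subsetD[OF Y that]])
  ultimately show ?thesis by auto
qed

subsection \<open>Regular bases\<close>

text \<open>With distinct degrees, the term of highest degree among those with nonzero coefficient
  cannot cancel.\<close>

lemma degree_le_combination:
  fixes c :: "'k poly \<Rightarrow> 'k"
  assumes "finite F" "inj_on degree F" "0 \<notin> F" "b \<in> F" "c b \<noteq> 0"
  shows "degree b \<le> degree (\<Sum>b\<in>F. smult (c b) b)" "(\<Sum>b\<in>F. smult (c b) b) \<noteq> 0"
proof -
  define F' where "F' = {b \<in> F. c b \<noteq> 0}"
  have F': "finite F'" "F' \<noteq> {}" using assms by (auto simp: F'_def)
  define m where "m = Max (degree ` F')"
  have "m \<in> degree ` F'" unfolding m_def using F' by (intro Max_in) auto
  then obtain b0 where b0: "b0 \<in> F'" "degree b0 = m" by blast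
  have le: "degree x \<le> m" if "x \<in> F'" for x unfolding m_def using F' that by (intro Max_ge) auto
  have "coeff (\<Sum>b\<in>F. smult (c b) b) m = (\<Sum>b\<in>F. c b * coeff b m)" by (simp add: coeff_sum)
  also have "\<dots> = (\<Sum>b\<in>{b0}. c b * coeff b m)"
  proof (rule sum.mono_neutral_right)
    show "\<forall>b\<in>F - {b0}. c b * coeff b m = 0"
    proof
      fix b assume b: "b \<in> F - {b0}"
      show "c b * coeff b m = 0"
      proof (cases "c b = 0")
        case False
        then have "degree b \<le> m" using b le by (simp add: F'_def)
        moreover have "degree b \<noteq> m" using b b0 inj_onD[OF assms(2), of b b0] by (auto simp: F'_def)
        ultimately show ?thesis by (simp add: coeff_eq_0)
      qed simp
    qed
  qed (use assms b0 in \<open>auto simp: F'_def\<close>)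
  also have "\<dots> \<noteq> 0" using b0 assms(3) by (auto simp: F'_def)
  finally have nz: "coeff (\<Sum>b\<in>F. smult (c b) b) m \<noteq> 0" .
  then show "(\<Sum>b\<in>F. smult (c b) b) \<noteq> 0" by auto
  have "degree b \<le> m" using assms le by (simp add: F'_def)
  then show "degree b \<le> degree (\<Sum>b\<in>F. smult (c b) b)" using le_degree[OF nz] by simp
qed

lemma Int_poly_zero: "0 \<in> Int_poly D"
  and Int_poly_add: "f \<in> Int_poly D \<Longrightarrow> g \<in> Int_poly D \<Longrightarrow> f + g \<in> Int_poly D"
  and Int_poly_diff: "f \<in> Int_poly D \<Longrightarrow> g \<in> Int_poly D \<Longrightarrow> f - g \<in> Int_poly D"
  and Int_poly_smult: "d \<in> D \<Longrightarrow> f \<in> Int_poly D \<Longrightarrow> smult d f \<in> Int_poly D"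
  by (auto simp: Int_poly_def zero_mem add_mem diff_mem mult_mem)

lemma Int_poly_sum: "(\<And>i. i \<in> A \<Longrightarrow> f i \<in> Int_poly D) \<Longrightarrow> sum f A \<in> Int_poly D"
  by (induction A rule: infinite_finite_induct) (auto simp: Int_poly_zero Int_poly_add)

text \<open>The generator is the leading coefficient of the basis element of degree
  \<open>n\<close>. In the expansion of an \<open>f\<close> of degree at most \<open>n\<close>,
  basis elements of larger degree have coefficient zero because leading terms cannot cancel, and
  those of smaller degree do not reach the coefficient of index \<open>n\<close>.\<close>

lemma regular_basis_principal:
  assumes B: "regular_basis D B" shows "principal_frac_ideal D (char_ideal D n)"
proof -
  have span: "Int_poly D = {\<Sum>b\<in>F. smult (c b) b |F c. finite F \<and> F \<subseteq> B \<and> c ` F \<subseteq> D}"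
    and indep: "\<forall>F c. finite F \<and> F \<subseteq> B \<and> c ` F \<subseteq> D \<and> (\<Sum>b\<in>F. smult (c b) b) = 0 \<longrightarrow> (\<forall>b\<in>F. c b = 0)"
    and deg: "\<forall>n. \<exists>!b. b \<in> B \<and> degree b = n"
    using B unfolding regular_basis_def poly_module_basis_def by simp_all
  have inj: "inj_on degree B" using deg by (auto intro!: inj_onI)
  have B0: "0 \<notin> B" using indep[rule_format, of "{0}" "\<lambda>_. 1" 0] one_mem by auto
  obtain b where b: "b \<in> B" "degree b = n" using deg by blast
  have "smult 1 b \<in> Int_poly D"
    unfolding span by (intro CollectI exI[of _ "{b}"] exI[of _ "\<lambda>_. 1"]) (use b one_mem in auto)
  then have bI: "b \<in> Int_poly D" by simp
  have "char_ideal D n = (*) (coeff b n) ` D"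
  proof
    show "(*) (coeff b n) ` D \<subseteq> char_ideal D n"
    proof safe
      fix d assume "d \<in> D"
      then show "coeff b n * d \<in> char_ideal D n"
        unfolding char_ideal_def using b bI
        by (intro CollectI exI[of _ "smult d b"]) (auto simp: Int_poly_smult mult.commute intro: order_trans[OF degree_smult_le])
    qed
    show "char_ideal D n \<subseteq> (*) (coeff b n) ` D"
    proof
      fix x assume "x \<in> char_ideal D n"
      then obtain f where f: "f \<in> Int_poly D" "degree f \<le> n" "x = coeff f n" by (auto simp: char_ideal_def)
      then obtain F c where F: "f = (\<Sum>b\<in>F. smult (c b) b)" "finite F" "F \<subseteq> B" "c ` F \<subseteq> D"
        unfolding span by blast
      have "c g * coeff g n = (if g = b then c b * coeff b n else 0)" if g: "g \<in> F" for g
      proof (cases "c g = 0 \<or> g = b")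
        case False
        have "degree g \<le> degree f" unfolding F(1)
          using degree_le_combination(1)[of F g c] False F g B0 inj_on_subset[OF inj] by blast
        moreover have "degree g \<noteq> n" using False inj_onD[OF inj, of g b] g F b by auto
        ultimately show ?thesis using False f(2) by (simp add: coeff_eq_0)
      qed auto
      then have "x = (\<Sum>g\<in>F. if g = b then c b * coeff b n else 0)"
        using f(3) F(1) by (simp add: coeff_sum)
      also have "\<dots> = coeff b n * (if b \<in> F then c b else 0)" using F(2) by (simp add: sum.delta)
      finally show "x \<in> (*) (coeff b n) ` D" using F(4) zero_mem by (cases "b \<in> F") auto
    qed
  qed
  moreover have "coeff b n \<noteq> 0" using b B0 by auto
  ultimately show ?thesis unfolding principal_iff by blast
qed

text \<open>Choose for each \<open>n\<close> an integer-valued polynomial whose leading coefficient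
  generates \<open>char_ideal D n\<close>; its degree is exactly \<open>n\<close> since the
  generator is nonzero. Subtracting \<open>D\<close>-multiples of these from the top down expands
  every integer-valued polynomial.\<close>

lemma principal_regular_basis:
  assumes "\<And>n. principal_frac_ideal D (char_ideal D n)" shows "\<exists>B. regular_basis D B"
proof -
  have "\<exists>f. f \<in> Int_poly D \<and> degree f = n \<and> f \<noteq> 0 \<and> char_ideal D n = (*) (coeff f n) ` D" for n
  proof -
    obtain c where c: "c \<noteq> 0" "char_ideal D n = (*) c ` D" using assms principal_iff by blast
    then have "c \<in> char_ideal D n" using one_mem by force
    then obtain f where f: "f \<in> Int_poly D" "degree f \<le> n" "c = coeff f n" by (auto simp: char_ideal_def)
    then have "degree f = n" using c le_degree[of f n] by auto
    then show ?thesis using f c by auto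
  qed
  then obtain f where f: "\<And>n. f n \<in> Int_poly D" "\<And>n. degree (f n) = n" "\<And>n. f n \<noteq> 0"
    "\<And>n. char_ideal D n = (*) (coeff (f n) n) ` D" by metis
  have inj: "inj f" using f(2) by (metis injI)
  have expansion: "\<exists>d. range d \<subseteq> D \<and> g = (\<Sum>k<n. smult (d k) (f k))"
    if "g \<in> Int_poly D" "\<And>i. n \<le> i \<Longrightarrow> coeff g i = 0" for n g
    using that
  proof (induction n arbitrary: g)
    case 0
    then show ?case using zero_mem by (intro exI[of _ "\<lambda>_. 0"]) (auto simp: poly_eq_iff)
  next
    case (Suc n)
    have "degree g \<le> n" using Suc.prems(2) by (intro degree_le) auto
    then have "coeff g n \<in> char_ideal D n" using Suc.prems(1) by (auto simp: char_ideal_def)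
    then obtain e where e: "e \<in> D" "coeff g n = coeff (f n) n * e" using f(4) by auto
    have "\<exists>d. range d \<subseteq> D \<and> g - smult e (f n) = (\<Sum>k<n. smult (d k) (f k))"
    proof (rule Suc.IH)
      show "g - smult e (f n) \<in> Int_poly D" by (intro Int_poly_diff Int_poly_smult Suc.prems(1) e f)
      show "coeff (g - smult e (f n)) i = 0" if "n \<le> i" for i
        using that e Suc.prems(2)[of i] f(2)[of n] by (cases "i = n") (auto simp: coeff_eq_0)
    qed
    then obtain d where d: "range d \<subseteq> D" "g - smult e (f n) = (\<Sum>k<n. smult (d k) (f k))" by blast
    have "g = (g - smult e (f n)) + smult e (f n)" by simp
    then show ?case using d e
      by (intro exI[of _ "d(n := e)"]) (auto simp: image_subset_iff)
  qed
  have "regular_basis D (range f)"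
    unfolding regular_basis_def poly_module_basis_def
  proof (intro conjI allI impI)
    show "Int_poly D = {\<Sum>b\<in>F. smult (c b) b |F c. finite F \<and> F \<subseteq> range f \<and> c ` F \<subseteq> D}"
    proof
      show "{\<Sum>b\<in>F. smult (c b) b |F c. finite F \<and> F \<subseteq> range f \<and> c ` F \<subseteq> D} \<subseteq> Int_poly D"
        using f(1) by (auto intro!: Int_poly_sum Int_poly_smult)
      show "Int_poly D \<subseteq> {\<Sum>b\<in>F. smult (c b) b |F c. finite F \<and> F \<subseteq> range f \<and> c ` F \<subseteq> D}"
      proof
        fix g assume "g \<in> Int_poly D"
        then obtain d where d: "range d \<subseteq> D" "g = (\<Sum>k<Suc (degree g). smult (d k) (f k))"
          using expansion[of g "Suc (degree g)"] by (auto simp: coeff_eq_0)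
        \<comment> \<open>A basis is a set of polynomials, so the coefficient of \<open>b\<close> is
          recovered through its degree.\<close>
        have "g = (\<Sum>b\<in>f ` {..<Suc (degree g)}. smult (d (degree b)) b)"
          by (subst sum.reindex[OF inj_on_subset[OF inj]]) (use d(2) f(2) in simp_all)
        then show "g \<in> {\<Sum>b\<in>F. smult (c b) b |F c. finite F \<and> F \<subseteq> range f \<and> c ` F \<subseteq> D}"
          using d(1) by (intro CollectI exI[of _ "f ` {..<Suc (degree g)}"] exI[of _ "\<lambda>b. d (degree b)"]) auto
      qed
    qed
    show "\<exists>!b. b \<in> range f \<and> degree b = n" for n using f(2) by (intro ex1I[of _ "f n"]) auto
    fix F c assume F: "finite F \<and> F \<subseteq> range f \<and> c ` F \<subseteq> D \<and> (\<Sum>b\<in>F. smult (c b) b) = 0"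
    have "inj_on degree (range f)" using f(2) by (auto intro!: inj_onI)
    then have "inj_on degree F" using F inj_on_subset by blast
    moreover have "0 \<notin> F" using F f(3) by auto
    ultimately show "\<forall>b\<in>F. c b = 0" using degree_le_combination(2)[of F _ c] F by metis
  qed
  then show ?thesis by blast
qed

end

context L_regular_t_domain
begin

subsection \<open>The Polya-Ostrowski group\<close>

lemma mem_TG: "char_ideal D n \<in> carrier TG" "factorial_ideal D n \<in> carrier TG" "Pi_ideal D n \<in> carrier TG"
  using t_char_ideal t_factorial_ideal t_ideal_Pi t_invertible_Pi by auto

text \<open>For \<open>q\<close> not a prime power, \<open>Pi_ideal D q = D\<close> contributes the
  trivial class, so the assumption covers every factor of \<open>fact_prod n\<close>.\<close>

lemma factorial_class_mem:
  assumes S: "subgroup S CG" and Pi: "\<And>q. primepow q \<Longrightarrow> t_class D (Pi_ideal D q) \<in> S"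
  shows "t_class D (factorial_ideal D n) \<in> S"
proof -
  have "t_class D (tc (Pi_ideal D q)) \<in> S" for q
    using Pi[of q] Pi_ideal_not_primepow[of q] t_class_D subgroup.one_closed[OF S]
    by (cases "primepow q") (auto simp: tc_t_ideal t_ideal_Pi tc_D)
  then show ?thesis
    unfolding factorial_ideal_eq_tc fact_prod_eq
    by (intro t_class_fprod_mem[OF S] t_class_pow_mem[OF S] t_invertible_pow t_invertible_Pi)
       (auto intro: finite_subset[of _ "{..n}"])
qed

text \<open>Since \<open>w\<^sub>q(q) = 1\<close>, the ideal \<open>\<Pi>\<^sub>q\<close> is, up to powers of \<open>\<Pi>\<^sub>r\<close> with \<open>r < q\<close>, the factorial of \<open>q\<close>.\<close>

lemma Pi_class_mem:
  assumes S: "subgroup S CG" and fact: "\<And>q. primepow q \<Longrightarrow> t_class D (factorial_ideal D q) \<in> S"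
  shows "t_class D (Pi_ideal D q) \<in> S"
proof (induction q rule: less_induct)
  case (less q)
  show ?case
  proof (cases "primepow q")
    case False
    then show ?thesis using t_class_D subgroup.one_closed[OF S] by (simp add: Pi_ideal_not_primepow)
  next
    case True
    then have q: "1 < q" using primepow_gt_Suc_0 by simp
    define A where "A = (\<lambda>r. Pi_ideal D r \<^bold>^ w_exp r q)"
    define L where "L = {r. 1 < r \<and> r < q}"
    have L: "finite L" "q \<notin> L" "{r. 1 < r \<and> r \<le> q} = insert q L"
      using q by (auto simp: L_def intro: finite_subset[of _ "{..q}"])
    have t: "t_invertible D (A r)" for r by (simp add: A_def t_invertible_pow t_invertible_Pi)
    have "A q = Pi_ideal D q" using w_exp_self[OF q] frac_Pi by (simp add: A_def ideal_mult_D frac_submod)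
    then have fp: "fact_prod q = Pi_ideal D q \<odot> fprod A L"
      using L t_invertible_frac[OF t] unfolding fact_prod_eq A_def[symmetric] L(3) by (subst fprod_insert) auto
    have rest: "t_class D (tc (fprod A L)) \<in> S"
    proof (rule t_class_fprod_mem[OF S L(1) t])
      fix r assume "r \<in> L"
      then show "t_class D (tc (A r)) \<in> S" unfolding A_def using less.IH[of r]
        by (intro t_class_pow_mem[OF S t_invertible_Pi]) (simp add: L_def tc_t_ideal t_ideal_Pi)
    qed
    have c: "t_class D (Pi_ideal D q) \<in> carrier CG" "t_class D (tc (fprod A L)) \<in> carrier CG"
      using mem_TG subgroup.mem_carrier[OF S rest] by auto
    have "t_class D (factorial_ideal D q) = t_class D (Pi_ideal D q) \<otimes>\<^bsub>CG\<^esub> t_class D (tc (fprod A L))"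
      unfolding factorial_ideal_eq_tc fp
      using t_class_mult[OF t_invertible_Pi t_invertible_fprod[OF L(1) t]] by (simp add: tc_t_ideal t_ideal_Pi)
    then have "t_class D (Pi_ideal D q) = t_class D (factorial_ideal D q) \<otimes>\<^bsub>CG\<^esub> inv\<^bsub>CG\<^esub> t_class D (tc (fprod A L))"
      using c by (simp add: CG.m_assoc)
    then show ?thesis
      using fact[OF True] rest by (simp add: subgroup.m_closed[OF S] subgroup.m_inv_closed[OF S])
  qed
qed

lemma factorial_class_iff:
  "subgroup S CG \<Longrightarrow> t_class D (factorial_ideal D n) \<in> S \<longleftrightarrow> t_class D (char_ideal D n) \<in> S"
  unfolding factorial_ideal_def by (rule t_class_inv_mem_iff) (auto simp: t_char_ideal)

text \<open>The inclusions form a cycle: from \<open>POG D\<close> to the \<open>Pi_ideal\<close>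
  classes by the product formula, to the factorial classes by solving for
  \<open>Pi_ideal D q\<close>, to the prime-power characteristic classes by inversion, and back to
  \<open>POG D\<close>.\<close>

lemma POG_generators:
  "POG D = generate CG (t_class D ` {factorial_ideal D q |q. primepow q})"
  "POG D = generate CG (t_class D ` {char_ideal D q |q. primepow q})"
  "POG D = generate CG (t_class D ` {Pi_ideal D q |q. primepow q})"
proof -
  let ?F = "{factorial_ideal D q |q. primepow q}" and ?C = "{char_ideal D q |q. primepow q}"
    and ?P = "{Pi_ideal D q |q. primepow q}"
  have sub: "subgroup (generate CG (t_class D ` ?F)) CG" "subgroup (generate CG (t_class D ` ?C)) CG"
    "subgroup (generate CG (t_class D ` ?P)) CG" "subgroup (POG D) CG"
    unfolding POG_def using mem_TG by (intro subgroup_generate_classes; blast)+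
  have incl: "t_class D I \<in> generate CG (t_class D ` Y)" if "I \<in> Y" for I Y
    using that by (intro generate.incl) blast
  have "POG D \<subseteq> generate CG (t_class D ` ?P)"
    unfolding POG_def
  proof (rule generate_classes_subset[OF sub(3)])
    fix I assume "I \<in> range (char_ideal D)"
    then obtain n where "I = char_ideal D n" by blast
    moreover have "t_class D (Pi_ideal D q) \<in> generate CG (t_class D ` ?P)" if "primepow q" for q
      by (rule incl) (use that in blast)
    ultimately show "t_class D I \<in> generate CG (t_class D ` ?P)"
      using factorial_class_mem[OF sub(3), of n] factorial_class_iff[OF sub(3), of n] by simp
  qed
  moreover have "generate CG (t_class D ` ?P) \<subseteq> generate CG (t_class D ` ?F)"
  proof (rule generate_classes_subset[OF sub(1)])
    fix I assume "I \<in> ?P"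
    then obtain q where "I = Pi_ideal D q" by blast
    moreover have "t_class D (factorial_ideal D r) \<in> generate CG (t_class D ` ?F)" if "primepow r" for r
      by (rule incl) (use that in blast)
    ultimately show "t_class D I \<in> generate CG (t_class D ` ?F)"
      using Pi_class_mem[OF sub(1), of q] by simp
  qed
  moreover have "generate CG (t_class D ` ?F) \<subseteq> generate CG (t_class D ` ?C)"
  proof (rule generate_classes_subset[OF sub(2)])
    fix I assume "I \<in> ?F"
    then obtain q where q: "I = factorial_ideal D q" "primepow q" by blast
    have "t_class D (char_ideal D q) \<in> generate CG (t_class D ` ?C)"
      by (rule incl) (use q in blast)
    then show "t_class D I \<in> generate CG (t_class D ` ?C)"
      using factorial_class_iff[OF sub(2), of q] q by simp
  qed
  moreover have "generate CG (t_class D ` ?C) \<subseteq> POG D"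
    unfolding POG_def by (intro CG.mono_generate image_mono) blast
  ultimately show "POG D = generate CG (t_class D ` ?F)" "POG D = generate CG (t_class D ` ?C)"
    "POG D = generate CG (t_class D ` ?P)" by blast+
qed

lemma POG_trivial_iff:
  "POG D = {\<one>\<^bsub>CG\<^esub>} \<longleftrightarrow> (\<forall>n. principal_frac_ideal D (char_ideal D n))"
  "POG D = {\<one>\<^bsub>CG\<^esub>} \<longleftrightarrow> (\<forall>q. primepow q \<longrightarrow> principal_frac_ideal D (factorial_ideal D q))"
  "POG D = {\<one>\<^bsub>CG\<^esub>} \<longleftrightarrow> (\<forall>q. primepow q \<longrightarrow> principal_frac_ideal D (char_ideal D q))"
  "POG D = {\<one>\<^bsub>CG\<^esub>} \<longleftrightarrow> (\<forall>q. primepow q \<longrightarrow> principal_frac_ideal D (Pi_ideal D q))"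
proof -
  show "POG D = {\<one>\<^bsub>CG\<^esub>} \<longleftrightarrow> (\<forall>n. principal_frac_ideal D (char_ideal D n))"
    unfolding POG_def using mem_TG by (subst generate_classes_trivial_iff) blast+
  show "POG D = {\<one>\<^bsub>CG\<^esub>} \<longleftrightarrow> (\<forall>q. primepow q \<longrightarrow> principal_frac_ideal D (factorial_ideal D q))"
    unfolding POG_generators(1) using mem_TG by (subst generate_classes_trivial_iff) blast+
  show "POG D = {\<one>\<^bsub>CG\<^esub>} \<longleftrightarrow> (\<forall>q. primepow q \<longrightarrow> principal_frac_ideal D (char_ideal D q))"
    unfolding POG_generators(2) using mem_TG by (subst generate_classes_trivial_iff) blast+
  show "POG D = {\<one>\<^bsub>CG\<^esub>} \<longleftrightarrow> (\<forall>q. primepow q \<longrightarrow> principal_frac_ideal D (Pi_ideal D q))"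
    unfolding POG_generators(3) using mem_TG by (subst generate_classes_trivial_iff) blast+
qed

lemma principal_factorial_iff:
  "principal_frac_ideal D (factorial_ideal D n) \<longleftrightarrow> principal_frac_ideal D (char_ideal D n)"
  using principal_inv char_ideal_eq_inv_factorial unfolding factorial_ideal_def by metis

lemma principal_Pi_iff:
  "(\<forall>n. principal_frac_ideal D (Pi_ideal D n)) \<longleftrightarrow> (\<forall>q. primepow q \<longrightarrow> principal_frac_ideal D (Pi_ideal D q))"
  using Pi_ideal_not_primepow principal_D by metis

end

theorem theorem4p3:
  fixes D :: "'k::field set"
  assumes dom: "domain_with_quotient_field D"
    and C1: "polynomially_L_regular D"
    and C2: "\<And>n::nat. finite {P \<in> t_Max D. ideal_norm D P \<le> enat n}"
    and C5: "\<And>P. \<lbrakk>P \<in> t_Max D; ideal_norm D P \<noteq> \<infinity>\<rbrakk> \<Longrightarrow> t_invertible D P"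
  shows
    "(\<forall>n::nat.
        (t_ideal D (char_ideal D n) \<and> t_invertible D (char_ideal D n)) \<and>
        (t_ideal D (factorial_ideal D n) \<and> t_invertible D (factorial_ideal D n)) \<and>
        (t_ideal D (Pi_ideal D n) \<and> t_invertible D (Pi_ideal D n)) \<and>
        char_ideal D n = ideal_inv D (factorial_ideal D n) \<and>
        char_ideal D n =
          (\<Otimes>\<^bsub>frac_ideals D\<^esub> P \<in> {P \<in> t_Max D. ideal_norm D P \<le> enat n}.
             ideal_inv D (P [^]\<^bsub>frac_ideals D\<^esub> w_exp (the_enat (ideal_norm D P)) n)) \<and>
        factorial_ideal D n =
          (\<Otimes>\<^bsub>frac_ideals D\<^esub> P \<in> {P \<in> t_Max D. ideal_norm D P \<le> enat n}.
             t_closure D (P [^]\<^bsub>frac_ideals D\<^esub> w_exp (the_enat (ideal_norm D P)) n)) \<and>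
        factorial_ideal D n =
          (\<Otimes>\<^bsub>frac_ideals D\<^esub> q \<in> {q. 1 < q \<and> q \<le> n}.
             t_closure D (Pi_ideal D q [^]\<^bsub>frac_ideals D\<^esub> w_exp q n)))
     \<and> POG D = generate (t_class_group D) (t_class D ` {factorial_ideal D q |q. primepow q})
     \<and> POG D = generate (t_class_group D) (t_class D ` {char_ideal D q |q. primepow q})
     \<and> POG D = generate (t_class_group D) (t_class D ` {Pi_ideal D q |q. primepow q})
     \<and> ((\<exists>B. regular_basis D B) \<longleftrightarrow> POG D = {\<one>\<^bsub>t_class_group D\<^esub>})
     \<and> (POG D = {\<one>\<^bsub>t_class_group D\<^esub>} \<longleftrightarrow> (\<forall>n. principal_frac_ideal D (char_ideal D n)))
     \<and> ((\<forall>n. principal_frac_ideal D (char_ideal D n)) \<longleftrightarrow> (\<forall>q. primepow q \<longrightarrow> principal_frac_ideal D (char_ideal D q)))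
     \<and> ((\<forall>q. primepow q \<longrightarrow> principal_frac_ideal D (char_ideal D q)) \<longleftrightarrow>
          (\<forall>n. principal_frac_ideal D (factorial_ideal D n)))
     \<and> ((\<forall>n. principal_frac_ideal D (factorial_ideal D n)) \<longleftrightarrow>
          (\<forall>q. primepow q \<longrightarrow> principal_frac_ideal D (factorial_ideal D q)))
     \<and> ((\<forall>q. primepow q \<longrightarrow> principal_frac_ideal D (factorial_ideal D q)) \<longleftrightarrow>
          (\<forall>n. principal_frac_ideal D (Pi_ideal D n)))
     \<and> ((\<forall>n. principal_frac_ideal D (Pi_ideal D n)) \<longleftrightarrow> (\<forall>q. primepow q \<longrightarrow> principal_frac_ideal D (Pi_ideal D q)))"
proof -
  interpret domain_with_quotient_field D by (rule dom)
  interpret L_regular_t_domain D by unfold_locales (use C1 C2 C5 in auto)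
  have t: "t_ideal D (char_ideal D n) \<and> t_invertible D (char_ideal D n)"
    "t_ideal D (factorial_ideal D n) \<and> t_invertible D (factorial_ideal D n)"
    "t_ideal D (Pi_ideal D n) \<and> t_invertible D (Pi_ideal D n)" for n
    using t_char_ideal t_factorial_ideal t_ideal_Pi t_invertible_Pi by auto
  have rb: "(\<exists>B. regular_basis D B) \<longleftrightarrow> POG D = {\<one>\<^bsub>t_class_group D\<^esub>}"
    unfolding POG_trivial_iff(1) using regular_basis_principal principal_regular_basis by blast
  have fact: "(\<forall>n. principal_frac_ideal D (factorial_ideal D n)) \<longleftrightarrow> POG D = {\<one>\<^bsub>t_class_group D\<^esub>}"
    unfolding POG_trivial_iff(1) principal_factorial_iff ..
  \<comment> \<open>Conditions (1) and (3) to (8) are all rewritten to triviality of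
    \<open>POG D\<close>, which turns each equivalence into an instance of reflexivity.\<close>
  show ?thesis
    unfolding rb fact principal_Pi_iff POG_trivial_iff(1)[symmetric] POG_trivial_iff(2)[symmetric]
      POG_trivial_iff(3)[symmetric] POG_trivial_iff(4)[symmetric]
    by (intro conjI allI refl;
        fact t[THEN conjunct1] t[THEN conjunct2] char_ideal_eq_inv_factorial
          char_ideal_eq_fprod[unfolded max_le_def norm_nat_def]
          factorial_ideal_eq_fprod[unfolded max_le_def norm_nat_def]
          factorial_ideal_eq_fprod_Pi POG_generators)
qed

end
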